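(* Let $E$ be a continuous tangent subbundle of rank $m$ on an $(m+n)$-dimensional manifold $M$, with modulus of continuity $w_1$ and transversal modulus of continuity $w_2$. Assume that $E$ is integrable and $$\lim_{s\to0}w_1(s)\,e^{w_2(s)/s}=0.$$ Then $E$ is uniquely integrable.
   Context: $M$ is a $C^r$ manifold, $r\ge1$. $E$ is integrable if through every point $p\in M$ there is a local integral manifold, i.e. an $m$-dimensional $C^1$ submanifold $N\ni p$ with $T_qN=E_q$ for all $q\in N$. $E$ is uniquely integrable if moreover whenever two integral manifolds intersect, their intersection is relatively open in both. Moduli $w$ are continuous increasing functions $w:I\subset\mathbb{R}^+\to\mathbb{R}^+$ with $\lim_{s\to0}w(s)=0$. The bundle $E$ has modulus of continuity $w$ if in every sufficiently small coordinate neighbourhood it can be spanned by linearly independent vector fields $X_1,\dots,X_m$ such that in the local coordinates $|X_i(p)-X_i(q)|\le w(|p-q|)$. $E$ has transversal modulus of continuity $w$ if for every $x_0\in M$ there is a coordinate neighbourhood $(V,(x^1,\dots,x^m,y^1,\dots,y^n))$ around $x_0$ such that $E$ is transverse to $\mathrm{span}\{\partial/\partial y^i\}_{i=1}^n$ and $E$ has modulus of continuity $w$ with respect to the coordinates $y^1,\dots,y^n$, i.e. on $V$ it is spanned by linearly independent vector fields whose components have modulus of continuity $w$ with respect to each variable $y^j$. Here a function $f$ has modulus of continuity $w$ with respect to a variable $\xi$ if there is a constant $K>0$ such that changing only that variable by a small amount $s$ (staying in the domain) changes $f$ by at most $Kw(|s|)$. *)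

theory Defs
  imports "HOL-Analysis.Analysis" "HOL-Library.Extended_Nat"
begin

section \<open>Maps of class \<open>C\<^sup>r\<close>\<close>

text \<open>On an open set \<open>S\<close>. Iterated directional derivatives are used because iterating the
  total derivative would change the type of the codomain.\<close>

fun Ck_on :: "nat \<Rightarrow> ('a::euclidean_space \<Rightarrow> 'b::euclidean_space) \<Rightarrow> 'a set \<Rightarrow> bool" where
  "Ck_on 0 f S \<longleftrightarrow> continuous_on S f"
| "Ck_on (Suc k) f S \<longleftrightarrow>
     (\<forall>x\<in>S. f differentiable (at x)) \<and>
     (\<forall>v. Ck_on k (\<lambda>x. frechet_derivative f (at x) v) S)"

definition Cr_on :: "enat \<Rightarrow> ('a::euclidean_space \<Rightarrow> 'b::euclidean_space) \<Rightarrow> 'a set \<Rightarrow> bool" where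
  "Cr_on r f S \<longleftrightarrow> (\<forall>k. enat k \<le> r \<longrightarrow> Ck_on k f S)"

section \<open>Manifolds\<close>

text \<open>A chart is a pair of its domain and its coordinate map; the values of the
  coordinate map outside the domain are irrelevant.\<close>

type_synonym ('a, 'd) chart = "'a set \<times> ('a \<Rightarrow> real^'d)"

definition is_chart :: "('a::topological_space, 'd::finite) chart \<Rightarrow> bool" where
  "is_chart c \<longleftrightarrow> open (fst c) \<and> open (snd c ` fst c) \<and>
     homeomorphism (fst c) (snd c ` fst c) (snd c) (inv_into (fst c) (snd c))"

definition transition :: "('a, 'd::finite) chart \<Rightarrow> ('a, 'd) chart \<Rightarrow> real^'d \<Rightarrow> real^'d" where
  "transition c d = snd d \<circ> inv_into (fst c) (snd c)"

definition compatible :: "enat \<Rightarrow> ('a, 'd::finite) chart \<Rightarrow> ('a, 'd) chart \<Rightarrow> bool" where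
  "compatible r c d \<longleftrightarrow>
     Cr_on r (transition c d) (snd c ` (fst c \<inter> fst d)) \<and>
     Cr_on r (transition d c) (snd d ` (fst c \<inter> fst d))"

text \<open>A \<open>C\<^sup>r\<close> manifold of dimension \<open>CARD('d)\<close> is given by an atlas, which need not be maximal.
  The underlying space is the union of the chart domains, an open subset of a Hausdorff,
  second countable space.\<close>

definition Cr_atlas :: "enat \<Rightarrow> ('a::{t2_space,second_countable_topology}, 'd::finite) chart set \<Rightarrow> bool" where
  "Cr_atlas r A \<longleftrightarrow> (\<forall>c\<in>A. is_chart c) \<and> (\<forall>c\<in>A. \<forall>d\<in>A. compatible r c d)"

definition carrier_of :: "('a, 'd) chart set \<Rightarrow> 'a set" where
  "carrier_of A = (\<Union>c\<in>A. fst c)"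

definition max_atlas ::
  "enat \<Rightarrow> ('a::topological_space, 'd::finite) chart set \<Rightarrow> ('a, 'd) chart set" where
  "max_atlas r A =
     {c. is_chart c \<and> fst c \<subseteq> carrier_of A \<and> (\<forall>d\<in>A. compatible r c d)}"

definition charts_at ::
  "enat \<Rightarrow> ('a::topological_space, 'd::finite) chart set \<Rightarrow> 'a \<Rightarrow> ('a, 'd) chart set" where
  "charts_at r A p = {c \<in> max_atlas r A. p \<in> fst c}"

section \<open>Tangent spaces and tangent subbundles\<close>

text \<open>A tangent vector at \<open>p\<close> is the family of its component vectors in all charts around \<open>p\<close>,
  transforming by the derivatives of the coordinate changes. It is set to \<open>0\<close> at
  all other arguments so that equality of tangent vectors is equality of functions.\<close>

type_synonym ('a, 'd) tvec = "('a, 'd) chart \<Rightarrow> real^'d"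

definition tangent_space ::
  "enat \<Rightarrow> ('a::topological_space, 'd::finite) chart set \<Rightarrow> 'a \<Rightarrow> ('a, 'd) tvec set" where
  "tangent_space r A p =
     {v. (\<forall>c\<in>charts_at r A p. \<forall>d\<in>charts_at r A p.
            v d = frechet_derivative (transition c d) (at (snd c p)) (v c)) \<and>
         (\<forall>c. c \<notin> charts_at r A p \<longrightarrow> v c = 0)}"

definition components :: "('a, 'd) chart \<Rightarrow> ('a, 'd) tvec set \<Rightarrow> (real^'d) set" where
  "components c F = (\<lambda>v. v c) ` F"

text \<open>The vector fields \<open>X 0, \<dots>, X (m - 1)\<close> on \<open>V\<close> are given by their components in the chart \<open>c\<close>.\<close>

definition local_frame ::
  "nat \<Rightarrow> ('a::topological_space \<Rightarrow> ('a, 'd::finite) tvec set) \<Rightarrow> ('a, 'd) chart \<Rightarrow> 'a set \<Rightarrow>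
     (nat \<Rightarrow> 'a \<Rightarrow> real^'d) \<Rightarrow> bool" where
  "local_frame m E c V X \<longleftrightarrow>
     (\<forall>i<m. continuous_on V (X i)) \<and>
     (\<forall>q\<in>V. inj_on (\<lambda>i. X i q) {..<m} \<and>
             independent ((\<lambda>i. X i q) ` {..<m}) \<and>
             span ((\<lambda>i. X i q) ` {..<m}) = components c (E q))"

definition tangent_subbundle ::
  "enat \<Rightarrow> ('a::topological_space, 'd::finite) chart set \<Rightarrow> nat \<Rightarrow> ('a \<Rightarrow> ('a, 'd) tvec set) \<Rightarrow> bool" where
  "tangent_subbundle r A m E \<longleftrightarrow>
     (\<forall>p\<in>carrier_of A. E p \<subseteq> tangent_space r A p \<and>
        (\<forall>c\<in>charts_at r A p. subspace (components c (E p)) \<and> dim (components c (E p)) = m))"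

definition continuous_subbundle ::
  "enat \<Rightarrow> ('a::topological_space, 'd::finite) chart set \<Rightarrow> nat \<Rightarrow> ('a \<Rightarrow> ('a, 'd) tvec set) \<Rightarrow> bool" where
  "continuous_subbundle r A m E \<longleftrightarrow>
     tangent_subbundle r A m E \<and>
     (\<forall>p\<in>carrier_of A. \<forall>c\<in>charts_at r A p.
        \<exists>V X. open V \<and> p \<in> V \<and> V \<subseteq> fst c \<and> local_frame m E c V X)"

section \<open>Submanifolds and integrability\<close>

text \<open>Embedded submanifolds, via slice charts of the \<open>C\<^sup>1\<close> structure.\<close>

definition C1_submanifold ::
  "('a::topological_space, 'd::finite) chart set \<Rightarrow> nat \<Rightarrow> 'a set \<Rightarrow> bool" where
  "C1_submanifold A m N \<longleftrightarrow> N \<subseteq> carrier_of A \<and>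
     (\<forall>q\<in>N. \<exists>c\<in>charts_at 1 A q. \<exists>K::'d set. card K = m \<and>
        snd c ` (fst c \<inter> N) = snd c ` fst c \<inter> {x. \<forall>i. i \<notin> K \<longrightarrow> x $ i = 0})"

text \<open>Tangent vectors to \<open>N\<close> at \<open>q\<close>: velocities at time 0 of \<open>C\<^sup>1\<close> curves in \<open>N\<close> through \<open>q\<close>.\<close>

definition tangent_to ::
  "enat \<Rightarrow> ('a::topological_space, 'd::finite) chart set \<Rightarrow> 'a set \<Rightarrow> 'a \<Rightarrow> ('a, 'd) tvec set" where
  "tangent_to r A N q =
     {v \<in> tangent_space r A q. \<exists>c\<in>charts_at r A q. \<exists>e>0. \<exists>\<gamma>.
        \<gamma> ` {-e<..<e} \<subseteq> N \<inter> fst c \<and> \<gamma> 0 = q \<and>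
        (snd c \<circ> \<gamma>) C1_differentiable_on {-e<..<e} \<and>
        (snd c \<circ> \<gamma> has_vector_derivative v c) (at 0)}"

definition integral_manifold ::
  "enat \<Rightarrow> ('a::topological_space, 'd::finite) chart set \<Rightarrow> nat \<Rightarrow> ('a \<Rightarrow> ('a, 'd) tvec set) \<Rightarrow>
     'a set \<Rightarrow> bool" where
  "integral_manifold r A m E N \<longleftrightarrow>
     C1_submanifold A m N \<and> (\<forall>q\<in>N. tangent_to r A N q = E q)"

definition integrable_bundle ::
  "enat \<Rightarrow> ('a::topological_space, 'd::finite) chart set \<Rightarrow> nat \<Rightarrow> ('a \<Rightarrow> ('a, 'd) tvec set) \<Rightarrow> bool" where
  "integrable_bundle r A m E \<longleftrightarrow>
     (\<forall>p\<in>carrier_of A. \<exists>N. p \<in> N \<and> integral_manifold r A m E N)"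

definition uniquely_integrable ::
  "enat \<Rightarrow> ('a::topological_space, 'd::finite) chart set \<Rightarrow> nat \<Rightarrow> ('a \<Rightarrow> ('a, 'd) tvec set) \<Rightarrow> bool" where
  "uniquely_integrable r A m E \<longleftrightarrow>
     integrable_bundle r A m E \<and>
     (\<forall>N\<^sub>1 N\<^sub>2. integral_manifold r A m E N\<^sub>1 \<and> integral_manifold r A m E N\<^sub>2 \<and> N\<^sub>1 \<inter> N\<^sub>2 \<noteq> {} \<longrightarrow>
        openin (top_of_set N\<^sub>1) (N\<^sub>1 \<inter> N\<^sub>2) \<and> openin (top_of_set N\<^sub>2) (N\<^sub>1 \<inter> N\<^sub>2))"

section \<open>Moduli of continuity\<close>

text \<open>The domain \<open>I\<close> is an interval reaching down to 0, with or without the point 0 itself.\<close>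

definition modulus :: "real set \<Rightarrow> (real \<Rightarrow> real) \<Rightarrow> bool" where
  "modulus I w \<longleftrightarrow>
     is_interval I \<and> I \<subseteq> {0..} \<and> (\<exists>a>0. {0<..<a} \<subseteq> I) \<and>
     (\<forall>s\<in>I. 0 \<le> w s) \<and> continuous_on I w \<and> mono_on I w \<and> (w \<longlongrightarrow> 0) (at 0 within I)"

text \<open>``Every sufficiently small coordinate neighbourhood'' refers to restrictions of the charts
  of the given atlas to small open sets. Charts of the maximal atlas are not demanded: a
  \<open>C\<^sup>1\<close> change of coordinates can destroy any given modulus. (A maximal atlas \<open>A\<close> is
  still an instance.)\<close>

definition has_modulus ::
  "('a::topological_space, 'd::finite) chart set \<Rightarrow> nat \<Rightarrow> ('a \<Rightarrow> ('a, 'd) tvec set) \<Rightarrow>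
     real set \<Rightarrow> (real \<Rightarrow> real) \<Rightarrow> bool" where
  "has_modulus A m E I w \<longleftrightarrow>
     (\<forall>c\<in>A. \<forall>x\<in>fst c. \<exists>W. open W \<and> x \<in> W \<and> W \<subseteq> fst c \<and>
        (\<forall>V. open V \<and> V \<subseteq> W \<longrightarrow>
           (\<exists>X. local_frame m E c V X \<and>
              (\<forall>i<m. \<forall>p\<in>V. \<forall>q\<in>V. norm (snd c p - snd c q) \<in> I \<longrightarrow>
                 norm (X i p - X i q) \<le> w (norm (snd c p - snd c q))))))"

definition modulus_wrt_variable ::
  "real set \<Rightarrow> (real \<Rightarrow> real) \<Rightarrow> 'd::finite \<Rightarrow> (real^'d) set \<Rightarrow> (real^'d \<Rightarrow> real) \<Rightarrow> bool" where
  "modulus_wrt_variable I w j D f \<longleftrightarrow>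
     (\<exists>K>0. \<exists>\<delta>>0. \<forall>z s. z \<in> D \<and> z + s *\<^sub>R axis j 1 \<in> D \<and> \<bar>s\<bar> < \<delta> \<and> \<bar>s\<bar> \<in> I \<longrightarrow>
        \<bar>f (z + s *\<^sub>R axis j 1) - f z\<bar> \<le> K * w \<bar>s\<bar>)"

text \<open>The \<open>n\<close> coordinates indexed by \<open>J\<close> play the role of \<open>y\<^sup>1, \<dots>, y\<^sup>n\<close>, the remaining ones that
  of the \<open>x\<close>-coordinates.\<close>

definition has_transversal_modulus ::
  "enat \<Rightarrow> ('a::topological_space, 'd::finite) chart set \<Rightarrow> nat \<Rightarrow> nat \<Rightarrow> ('a \<Rightarrow> ('a, 'd) tvec set) \<Rightarrow>
     real set \<Rightarrow> (real \<Rightarrow> real) \<Rightarrow> bool" where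
  "has_transversal_modulus r A m n E I w \<longleftrightarrow>
     (\<forall>x\<^sub>0\<in>carrier_of A. \<exists>c\<in>charts_at r A x\<^sub>0. \<exists>J::'d set. card J = n \<and>
        (\<forall>q\<in>fst c. {a + b | a b. a \<in> components c (E q) \<and> b \<in> span ((\<lambda>j. axis j 1) ` J)} = UNIV) \<and>
        (\<exists>X. local_frame m E c (fst c) X \<and>
           (\<forall>i<m. \<forall>k. \<forall>j\<in>J. modulus_wrt_variable I w j (snd c ` fst c)
              (\<lambda>z. X i (inv_into (fst c) (snd c) z) $ k))))"

end

theory Submission
  imports Defs
begin

text \<open>Suppose first that \<open>w\<^sub>1 s \<ge> c * s\<close> near \<open>0\<close> for some \<open>c > 0\<close>. Then the growth condition forces
  \<open>w\<^sub>2 s \<le> 2 * s * ln (1 / s)\<close>, so \<open>E\<close> is log-Lipschitz in the transversal directions. A curve in one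
  integral manifold is lifted to a curve in another one with the same projection along the
  transversal; the difference of the two curves satisfies the Osgood inequality
  \<open>|f'| \<le> C |f| ln (1 / |f|)\<close> and hence vanishes. The constants in the transversal modulus are
  harmless, since Osgood's criterion does not see them. If no such \<open>c\<close> exists, then subdividing
  segments shows that \<open>E\<close> is locally constant in the charts of the atlas, and the same argument applies
  with vanishing variation of \<open>E\<close>.\<close>

section \<open>Osgood uniqueness and frames\<close>

text \<open>The limit condition controls \<open>w\<^sub>2\<close> only through a lower bound on
  \<open>w\<^sub>1\<close>: a vanishing \<open>w\<^sub>1\<close> satisfies it together with every
  \<open>w\<^sub>2\<close>. This is why \<open>w\<^sub>1\<close> decides the case distinction.

  Lifting along the transversal keeps the two curves in a common fibre of a projection
  \<open>\<pi>\<close>. Their difference then points in the transversal directions only, which are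
  the directions in which the better modulus is available.

  Two obstacles shape the rest. The velocities of the two curves are combinations of the same frame
  at different points, with different coefficients, so a bound on the frame does not yet compare
  them; what compares them is that their projections agree and that projections control
  coefficients. Moreover, slice charts of an integral manifold are only of class
  \<open>C\<^sup>1\<close> and unrelated to the chart in which the modulus holds. The slice is
  therefore carried into that chart by the coordinate change, and the inverse function theorem turns
  it into a section of \<open>\<pi>\<close> there.\<close>

text \<open>The function ln (ln (1 / norm f)) has derivative bounded by \<open>C\<close> wherever
  \<open>f\<close> does not vanish, so it cannot run off to infinity on an interval of finite
  length. Beyond the last zero of \<open>f\<close> it would have to. The smallness assumption keeps
  ln (1 / norm f) above 1, so that the second logarithm is defined.\<close>

lemma osgood_zero:
  fixes f :: "real \<Rightarrow> 'a::real_inner"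
  assumes der: "\<And>t. t \<in> {0..1} \<Longrightarrow> (f has_vector_derivative f' t) (at t within {0..1})"
    and f0: "f 0 = 0"
    and small: "\<And>t. t \<in> {0..1} \<Longrightarrow> norm (f t) < exp (- 1)"
    and bound: "\<And>t. t \<in> {0..1} \<Longrightarrow> f t \<noteq> 0 \<Longrightarrow> norm (f' t) \<le> C * (norm (f t) * ln (1 / norm (f t)))"
  shows "f 1 = 0"
proof (rule ccontr)
  assume f1: "f 1 \<noteq> 0"
  have contf: "continuous_on {0..1} f"
    using der has_vector_derivative_continuous continuous_on_eq_continuous_within by blast
  define Z where "Z = {t \<in> {0..1}. f t = 0}"
  have "closed Z" unfolding Z_def
    using continuous_closed_preimage_constant[OF contf] by (auto simp: vimage_def Int_def)
  moreover have "Z \<subseteq> {0..1}" by (auto simp: Z_def)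
  ultimately have "compact Z" by (meson bounded_closed_interval bounded_subset compact_eq_bounded_closed)
  moreover have "0 \<in> Z" using f0 by (auto simp: Z_def)
  hence "Z \<noteq> {}" by blast
  ultimately obtain a where a: "a \<in> Z" "\<And>t. t \<in> Z \<Longrightarrow> t \<le> a"
    using compact_attains_sup[of Z] by auto
  have a01: "0 \<le> a" "f a = 0" "a \<le> 1" using a(1) by (auto simp: Z_def)
  with f1 have a1: "a < 1" by (metis order.order_iff_strict)
  have nz: "f t \<noteq> 0" if "a < t" "t \<le> 1" for t
    using a(2)[of t] that a01 by (auto simp: Z_def)
  define g where "g t = ln (1 / norm (f t))" for t
  have g1: "1 < g t" if "a < t" "t \<le> 1" for t
  proof -
    have "norm (f t) < exp (-1)" using small that a01 by auto
    moreover have "norm (f t) > 0" using nz that by simp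
    ultimately have "ln (norm (f t)) < - 1" using ln_less_cancel_iff[of "norm (f t)" "exp (-1)"] by simp
    thus ?thesis using \<open>norm (f t) > 0\<close> by (simp add: g_def ln_div)
  qed
  have C: "0 \<le> C"
  proof -
    have "0 \<le> C * (norm (f 1) * g 1)"
      using order_trans[OF norm_ge_zero bound[of 1]] f1 by (simp add: g_def)
    moreover have "norm (f 1) * g 1 > 0" using g1[of 1] f1 a1 by simp
    ultimately show ?thesis by (simp add: zero_le_mult_iff)
  qed
  define h where "h t = ln (g t)" for t
  define h' where "h' t = - (f t \<bullet> f' t) / (norm (f t))\<^sup>2 / g t" for t
  have dh: "(h has_real_derivative h' t) (at t within {s..1})" if s: "a < s" "s \<le> t" "t \<le> 1" for s t
  proof -
    have 1: "(f has_derivative (\<lambda>x. x *\<^sub>R f' t)) (at t within {s..1})"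
      using der[of t] s a01 unfolding has_vector_derivative_def
      by (auto intro: has_derivative_subset)
    have nf: "f t \<noteq> 0" using nz s by auto
    have "((\<lambda>t. norm (f t)) has_derivative (\<lambda>x. (x *\<^sub>R f' t) \<bullet> sgn (f t))) (at t within {s..1})"
      using has_derivative_compose[OF 1 has_derivative_norm[OF nf]] by simp
    hence 2: "((\<lambda>t. norm (f t)) has_real_derivative (f' t \<bullet> sgn (f t))) (at t within {s..1})"
      unfolding has_field_derivative_def by (rule has_derivative_eq_rhs) (auto simp: mult.commute)
    have gt: "g t > 0" using g1[of t] s by simp
    have nft: "norm (f t) > 0" using nf by simp
    have "(g has_real_derivative (- (f' t \<bullet> sgn (f t)) / norm (f t))) (at t within {s..1})"
    proof -
      have "((\<lambda>t. - ln (norm (f t))) has_real_derivative - (inverse (norm (f t)) * (f' t \<bullet> sgn (f t)))) (at t within {s..1})"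
        by (rule DERIV_minus, rule DERIV_chain2[OF DERIV_ln[OF nft] 2])
      moreover have "g = (\<lambda>t. - ln (norm (f t)))" by (simp add: g_def fun_eq_iff ln_div)
      ultimately show ?thesis using nft by (simp add: divide_inverse mult.commute)
    qed
    hence "(h has_real_derivative ((- (f' t \<bullet> sgn (f t)) / norm (f t)) / g t)) (at t within {s..1})"
      unfolding h_def using DERIV_chain2[where g = g, OF DERIV_ln[OF gt]] by (fastforce simp: divide_inverse mult.commute)
    moreover have "(- (f' t \<bullet> sgn (f t)) / norm (f t)) / g t = h' t"
      unfolding h'_def using nft by (simp add: sgn_div_norm inner_commute power2_eq_square field_simps)
    ultimately show ?thesis by simp
  qed
  have h'b: "\<bar>h' t\<bar> \<le> C" if s: "a < t" "t \<le> 1" for t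
  proof -
    have nft: "norm (f t) > 0" and gt: "g t > 0" using nz s g1[of t] by auto
    have "\<bar>f t \<bullet> f' t\<bar> \<le> norm (f t) * norm (f' t)" by (rule Cauchy_Schwarz_ineq2)
    also have "\<dots> \<le> norm (f t) * (C * (norm (f t) * g t))"
      using bound[of t] s a01 nft unfolding g_def by (intro mult_left_mono) auto
    finally have "\<bar>f t \<bullet> f' t\<bar> \<le> C * ((norm (f t))\<^sup>2 * g t)" by (simp add: power2_eq_square ac_simps)
    thus ?thesis unfolding h'_def using nft gt by (simp add: abs_mult field_simps)
  qed
  have hb: "h s \<le> h 1 + C" if s: "a < s" "s < 1" for s
  proof -
    have "\<exists>x\<in>{s<..<1}. h 1 - h s = h' x * (1 - s)"
      by (rule mvt_simple[OF s(2)]) (use dh[OF s(1)] in \<open>simp add: has_field_derivative_def\<close>)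
    then obtain x where x: "x \<in> {s<..<1}" "h 1 - h s = (1 - s) * h' x"
      by (auto simp: mult.commute)
    have "\<bar>(1 - s) * h' x\<bar> \<le> 1 * C" unfolding abs_mult
      using h'b[of x] s x a01 by (intro mult_mono) auto
    thus ?thesis using x by linarith
  qed
  \<comment> \<open>This is the norm at which ln (ln (1 / norm)) equals \<open>h 1 + C\<close>, the
    upper bound for \<open>h\<close> just obtained.\<close>
  define \<epsilon> where "\<epsilon> = exp (- exp (h 1 + C))"
  have lb: "\<epsilon> \<le> norm (f s)" if s: "a < s" "s < 1" for s
  proof -
    have "exp (h s) \<le> exp (h 1 + C)" using hb[OF s] by simp
    hence "g s \<le> exp (h 1 + C)" using g1[of s] s unfolding h_def by (subst (asm) exp_ln) auto
    moreover have "norm (f s) > 0" using nz s by simp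
    ultimately have "- exp (h 1 + C) \<le> ln (norm (f s))" by (simp add: g_def ln_div)
    thus ?thesis unfolding \<epsilon>_def using \<open>norm (f s) > 0\<close> using exp_le_cancel_iff[of "- exp (h 1 + C)" "ln (norm (f s))"] by simp
  qed
  have "continuous_on {a..1} f" using contf by (rule continuous_on_subset) (use a01 a1 in auto)
  then have "(f \<longlongrightarrow> f a) (at_right a)"
    using a1 by (simp add: continuous_on_Icc_at_rightD)
  hence "((\<lambda>s. norm (f s)) \<longlongrightarrow> 0) (at_right a)" using a01 tendsto_norm by fastforce
  moreover have "\<forall>\<^sub>F s in at_right a. \<epsilon> \<le> norm (f s)"
    using eventually_at_right_less[of a] eventually_at_right_real[of a 1] a1 lb
    by (auto elim: eventually_mono)
  ultimately have "\<epsilon> \<le> 0" by (intro tendsto_lowerbound[of _ _ "at_right a"]) auto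
  thus False by (simp add: \<epsilon>_def)
qed

text \<open>The linear functionals \<open>g i\<close> dual to the independent family \<open>\<pi> (X i z0)\<close> recover the
  coefficients at \<open>z0\<close>, and by continuity up to a factor near \<open>z0\<close>.\<close>

lemma frame_coefficients_bound:
  fixes X :: "nat \<Rightarrow> 'a::euclidean_space \<Rightarrow> 'b::euclidean_space" and \<pi> :: "'b \<Rightarrow> 'c::euclidean_space"
  assumes cont: "\<And>i. i < m \<Longrightarrow> isCont (X i) z0"
    and inj: "inj_on (\<lambda>i. X i z0) {..<m}"
    and ind: "independent ((\<lambda>i. X i z0) ` {..<m})"
    and lin: "linear \<pi>"
    and ker: "\<And>v. v \<in> span ((\<lambda>i. X i z0) ` {..<m}) \<Longrightarrow> \<pi> v = 0 \<Longrightarrow> v = 0"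
  obtains C e where "0 < C" "0 < e"
    "\<And>z a. dist z z0 < e \<Longrightarrow> (\<Sum>i<m. \<bar>a i\<bar>) \<le> C * norm (\<pi> (\<Sum>i<m. a i *\<^sub>R X i z))"
proof -
  interpret \<pi>: linear \<pi> by (rule lin)
  define Y where "Y i = \<pi> (X i z0)" for i
  have injpi: "inj_on \<pi> (span ((\<lambda>i. X i z0) ` {..<m}))"
    using ker linear_injective_on_subspace_0[OF lin subspace_span] by blast
  have Yimg: "Y ` {..<m} = \<pi> ` ((\<lambda>i. X i z0) ` {..<m})" by (auto simp: Y_def)
  have indY: "independent (Y ` {..<m})"
    unfolding Yimg by (rule linear_independent_injective_image[OF lin ind injpi])
  have injY: "inj_on Y {..<m}"
    unfolding Y_def using comp_inj_on[OF inj inj_on_subset[OF injpi span_superset]] by (simp add: comp_def)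
  have "\<exists>g::'c \<Rightarrow> real. linear g \<and> (\<forall>j<m. g (Y j) = (if j = i then 1 else 0))" for i
  proof -
    obtain g :: "'c \<Rightarrow> real" where "linear g" "\<forall>x\<in>Y ` {..<m}. g x = (if x = Y i then 1 else 0)"
      using linear_independent_extend[OF indY, of "\<lambda>x. if x = Y i then 1 else 0"] by auto
    show ?thesis
    proof (cases "i < m")
      case True
      show ?thesis
        by (rule exI[of _ g]) (use \<open>linear g\<close> \<open>\<forall>x\<in>Y ` {..<m}. _ x\<close> injY True in \<open>auto simp: inj_on_eq_iff\<close>)
    next
      case False
      show ?thesis by (rule exI[of _ "\<lambda>_. 0"]) (use False in \<open>auto simp: linear_zero\<close>)
    qed
  qed
  then obtain g :: "nat \<Rightarrow> 'c \<Rightarrow> real" where lg: "\<And>i. linear (g i)"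
    and gY: "\<And>i j. j < m \<Longrightarrow> g i (Y j) = (if j = i then 1 else 0)" by metis
  have "\<exists>B>0. \<forall>v. norm (g i v) \<le> B * norm v" for i
    using linear_bounded_pos[OF lg[of i]] by blast
  then obtain B where B: "\<And>i. B i > 0" "\<And>i v. norm (g i v) \<le> B i * norm v" by metis
  obtain P where P: "P > 0" "\<And>v. norm (\<pi> v) \<le> P * norm v"
    using linear_bounded_pos[OF lin] by blast
  \<comment> \<open>\<open>G\<close> bounds the coefficients at \<open>z0\<close>; the summand 1
    keeps it positive for \<open>m = 0\<close>. The threshold \<open>1 / (2 * G * P)\<close> below
    makes the passage from \<open>z0\<close> to \<open>z\<close> cost at most
    \<open>S / (2 * G)\<close>, so half of \<open>S\<close> can be absorbed on the left.\<close>
  define G where "G = (\<Sum>i<m. B i) + 1"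
  have G: "G > 0" unfolding G_def using B(1) by (simp add: add_nonneg_pos sum_nonneg less_imp_le)
  have "\<forall>\<^sub>F z in at z0. \<forall>i\<in>{..<m}. dist (X i z) (X i z0) < 1 / (2 * G * P)"
    by (intro eventually_ball_finite ballI tendstoD) (use cont G P in \<open>auto simp: isCont_def\<close>)
  then obtain e where e: "e > 0" "\<And>z. z \<noteq> z0 \<Longrightarrow> dist z z0 < e \<Longrightarrow> \<forall>i\<in>{..<m}. dist (X i z) (X i z0) < 1 / (2 * G * P)"
    unfolding eventually_at by blast
  have e2: "dist (X i z) (X i z0) \<le> 1 / (2 * G * P)" if "dist z z0 < e" "i < m" for i z
    using e(2)[of z] that G P by (cases "z = z0") (auto intro: less_imp_le)
  have "(\<Sum>i<m. \<bar>a i\<bar>) \<le> (2 * G) * norm (\<pi> (\<Sum>i<m. a i *\<^sub>R X i z))" if z: "dist z z0 < e" for z a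
  proof -
    define S where "S = (\<Sum>i<m. \<bar>a i\<bar>)"
    define u where "u = \<pi> (\<Sum>i<m. a i *\<^sub>R X i z)"
    define u0 where "u0 = \<pi> (\<Sum>i<m. a i *\<^sub>R X i z0)"
    have u0: "u0 = (\<Sum>i<m. a i *\<^sub>R Y i)" unfolding u0_def Y_def by (simp add: \<pi>.sum \<pi>.scaleR)
    have ga: "g i u0 = a i" if "i < m" for i
    proof -
      interpret g: linear "g i" by (rule lg)
      have "g i u0 = (\<Sum>j<m. a j * (if j = i then 1 else 0))"
        unfolding u0 g.sum by (intro sum.cong) (auto simp: g.scaleR gY)
      also have "\<dots> = (\<Sum>j<m. if i = j then a j else 0)" by (intro sum.cong) auto
      also have "\<dots> = a i" using that by (simp add: sum.delta)
      finally show ?thesis .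
    qed
    have "S \<le> (\<Sum>i<m. B i * norm u0)" unfolding S_def
      by (intro sum_mono) (metis B(2) ga lessThan_iff real_norm_def)
    also have "\<dots> = (\<Sum>i<m. B i) * norm u0" by (simp add: sum_distrib_right)
    also have "\<dots> \<le> G * norm u0" by (intro mult_right_mono) (auto simp: G_def)
    finally have 1: "S \<le> G * norm u0" .
    have "norm (u0 - u) = norm (\<pi> (\<Sum>i<m. a i *\<^sub>R (X i z0 - X i z)))"
      unfolding u0_def u_def by (simp add: \<pi>.diff[symmetric] sum_subtractf[symmetric] scaleR_diff_right)
    also have "\<dots> \<le> P * norm (\<Sum>i<m. a i *\<^sub>R (X i z0 - X i z))" by (rule P)
    also have "\<dots> \<le> P * (\<Sum>i<m. \<bar>a i\<bar> * (1 / (2 * G * P)))"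
    proof (intro mult_left_mono order_trans[OF norm_sum] sum_mono)
      show "norm (a i *\<^sub>R (X i z0 - X i z)) \<le> \<bar>a i\<bar> * (1 / (2 * G * P))" if "i \<in> {..<m}" for i
        unfolding norm_scaleR using e2[OF z, of i] that
        by (intro mult_left_mono) (auto simp: dist_norm norm_minus_commute)
    qed (use P in auto)
    also have "\<dots> = S / (2 * G)" unfolding S_def using P by (simp add: sum_distrib_right[symmetric] sum_divide_distrib[symmetric])
    finally have 2: "norm (u0 - u) \<le> S / (2 * G)" .
    have "norm u0 \<le> norm u + S / (2 * G)" using 2 norm_triangle_sub[of u0 u] by linarith
    hence "S \<le> G * (norm u + S / (2 * G))"
      using order_trans[OF 1 mult_left_mono] G by (simp add: less_imp_le)
    also have "\<dots> = G * norm u + S / 2" using G by (simp add: field_simps)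
    finally show ?thesis unfolding S_def u_def by simp
  qed
  thus thesis using that[of "2 * G" e] G e(1) by simp
qed

section \<open>Slices in Euclidean space\<close>

text \<open>The set serves two ends: with the index set of a slice chart it is the model slice of
  \<open>C1_submanifold\<close>, and with the transversal indices it is the kernel of the projection
  along them.\<close>

definition coordinate_plane :: "'d set \<Rightarrow> (real^'d::finite) set" where
  "coordinate_plane K = {x. \<forall>i. i \<notin> K \<longrightarrow> x $ i = 0}"

lemma subspace_coordinate_plane: "subspace (coordinate_plane K)"
  by (auto simp: subspace_def coordinate_plane_def)

text \<open>There are as many coordinates outside \<open>K\<close> as vectors in a basis of
  \<open>T\<close>, so a bijection between them defines \<Lambda>; independence of the basis keeps
  the kernel from being larger than the plane.\<close>

lemma exists_linear_with_kernel_coordinate_plane: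
  fixes T :: "(real^'d::finite) set"
  assumes "subspace T" and "card K + dim T = CARD('d)"
  obtains \<Lambda> :: "real^'d \<Rightarrow> real^'d" where "linear \<Lambda>" "range \<Lambda> \<subseteq> T"
    "\<And>x. \<Lambda> x = 0 \<longleftrightarrow> x \<in> coordinate_plane K"
proof -
  obtain B where B: "B \<subseteq> T" "independent B" "card B = dim T"
    using basis_exists[of T] by metis
  have fB: "finite B" using B(2) independent_imp_finite by blast
  have "card (- K) = card B" using assms B by (simp add: Compl_eq_Diff_UNIV card_Diff_subset)
  then obtain h where h: "bij_betw h (- K) B"
    using fB finite_same_card_bij[of "- K" B] by auto
  define \<Lambda> where "\<Lambda> x = (\<Sum>i\<in>-K. x $ i *\<^sub>R h i)" for x :: "real^'d"
  have "linear \<Lambda>" unfolding \<Lambda>_def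
    by (intro linearI) (auto simp: scaleR_add_left sum.distrib scaleR_sum_right)
  moreover have "range \<Lambda> \<subseteq> T" unfolding \<Lambda>_def
    using B(1) h assms(1) by (auto intro!: subspace_sum subspace_scale dest: bij_betwE)
  moreover have "\<Lambda> x = 0 \<longleftrightarrow> x \<in> coordinate_plane K" for x
  proof
    assume 0: "\<Lambda> x = 0"
    have "\<Lambda> x = (\<Sum>b\<in>B. x $ (inv_into (-K) h b) *\<^sub>R b)"
      unfolding \<Lambda>_def sum.reindex_bij_betw[OF h, symmetric]
      using h by (intro sum.cong) (auto simp: bij_betw_def)
    hence *: "x $ (inv_into (-K) h b) = 0" if "b \<in> B" for b
      using 0 B(2) that unfolding independent_explicit by auto
    have "x $ i = 0" if "i \<notin> K" for i
      using *[of "h i"] h that by (auto simp: bij_betw_def)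
    thus "x \<in> coordinate_plane K" by (simp add: coordinate_plane_def)
  qed (auto simp: coordinate_plane_def \<Lambda>_def intro!: sum.neutral)
  ultimately show thesis by (rule that)
qed

text \<open>An integral manifold of \<open>F\<close> seen in a fixed chart: \<open>\<tau>\<close> is the coordinate change from
  a slice chart with slice \<open>coordinate_plane K\<close>.\<close>

definition slice_parametrization ::
  "(real^'d \<Rightarrow> (real^'d) set) \<Rightarrow> 'd set \<Rightarrow> (real^'d \<Rightarrow> real^'d) \<Rightarrow> (real^'d \<Rightarrow> real^'d \<Rightarrow> real^'d) \<Rightarrow>
     real^'d::finite \<Rightarrow> real \<Rightarrow> bool" where
  "slice_parametrization F K \<tau> \<tau>' x0 e \<longleftrightarrow>
     0 < e \<and> x0 \<in> coordinate_plane K \<and> inj (\<tau>' x0) \<and>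
     (\<forall>x\<in>ball x0 e. (\<tau> has_derivative \<tau>' x) (at x)) \<and>
     (\<forall>v. continuous_on (ball x0 e) (\<lambda>x. \<tau>' x v)) \<and>
     (\<forall>x\<in>ball x0 e \<inter> coordinate_plane K. \<forall>v\<in>coordinate_plane K. \<tau>' x v \<in> F (\<tau> x))"

text \<open>The inverse function theorem is applied to \<open>\<pi> \<circ> \<tau> + \<Lambda>\<close>, where \<open>\<Lambda>\<close> vanishes on the slice and
  has values in the kernel of the projection \<open>\<pi>\<close>.\<close>

lemma slice_section:
  fixes \<pi> :: "real^'d::finite \<Rightarrow> real^'d"
  assumes par: "slice_parametrization F K \<tau> \<tau>' x0 e"
    and lin: "linear \<pi>" and idem: "\<And>v. \<pi> (\<pi> v) = \<pi> v"
    and dim: "card K + dim {v. \<pi> v = 0} = CARD('d)"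
    and trans: "\<And>v. v \<in> F (\<tau> x0) \<Longrightarrow> \<pi> v = 0 \<Longrightarrow> v = 0"
  obtains \<rho> \<sigma> \<sigma>' where "0 < \<rho>" "\<sigma> (\<pi> (\<tau> x0)) = x0"
    "\<And>y. y \<in> ball (\<pi> (\<tau> x0)) \<rho> \<Longrightarrow> \<sigma> y \<in> ball x0 e"
    "\<And>y. y \<in> ball (\<pi> (\<tau> x0)) \<rho> \<Longrightarrow> \<pi> (\<tau> (\<sigma> y)) = \<pi> y"
    "\<And>y. y \<in> ball (\<pi> (\<tau> x0)) \<rho> \<Longrightarrow> \<pi> y = y \<Longrightarrow> \<sigma> y \<in> coordinate_plane K"
    "\<And>y. y \<in> ball (\<pi> (\<tau> x0)) \<rho> \<Longrightarrow> (\<sigma> has_derivative \<sigma>' y) (at y)"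
    "\<And>y v. y \<in> ball (\<pi> (\<tau> x0)) \<rho> \<Longrightarrow> \<pi> v = v \<Longrightarrow> \<sigma>' y v \<in> coordinate_plane K"
proof -
  interpret \<pi>: linear \<pi> by (rule lin)
  have e: "0 < e" and x0: "x0 \<in> coordinate_plane K" and inj0: "inj (\<tau>' x0)"
    and der: "\<And>x. x \<in> ball x0 e \<Longrightarrow> (\<tau> has_derivative \<tau>' x) (at x)"
    and cont: "\<And>v. continuous_on (ball x0 e) (\<lambda>x. \<tau>' x v)"
    and tan: "\<And>v. v \<in> coordinate_plane K \<Longrightarrow> \<tau>' x0 v \<in> F (\<tau> x0)"
    using par unfolding slice_parametrization_def by auto
  have "subspace {v. \<pi> v = 0}" by (rule linear_subspace_kernel[OF lin])
  then obtain \<Lambda> where lL: "linear \<Lambda>" and rL: "range \<Lambda> \<subseteq> {v. \<pi> v = 0}"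
    and kL: "\<And>x. \<Lambda> x = 0 \<longleftrightarrow> x \<in> coordinate_plane K"
    using exists_linear_with_kernel_coordinate_plane[OF _ dim] by metis
  have piL: "\<pi> (\<Lambda> x) = 0" for x using rL by auto
  have bL: "bounded_linear \<Lambda>" using lL by (rule linear_conv_bounded_linear[THEN iffD1])
  have bpi: "bounded_linear \<pi>" using lin by (rule linear_conv_bounded_linear[THEN iffD1])
  define \<Psi> where "\<Psi> x = \<pi> (\<tau> x) + \<Lambda> x" for x
  define \<Psi>' where "\<Psi>' x v = \<pi> (\<tau>' x v) + \<Lambda> v" for x v
  define D where "D x = Blinfun (\<Psi>' x)" for x
  have bl': "bounded_linear (\<Psi>' x)" if "x \<in> ball x0 e" for x
    unfolding \<Psi>'_def using der[OF that] bL bpi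
    by (intro bounded_linear_add bounded_linear_compose[OF bpi]) (auto dest: has_derivative_bounded_linear)
  have D: "blinfun_apply (D x) = \<Psi>' x" if "x \<in> ball x0 e" for x
    unfolding D_def using bounded_linear_Blinfun_apply[OF bl'[OF that]] .
  have derP: "(\<Psi> has_derivative blinfun_apply (D x)) (at x)" if "x \<in> ball x0 e" for x
    unfolding D[OF that] unfolding \<Psi>_def \<Psi>'_def
    by (intro has_derivative_add bounded_linear.has_derivative[OF bpi] der[OF that]
        bounded_linear_imp_has_derivative bL)
  have contD: "continuous_on (ball x0 e) D"
  proof (rule continuous_on_blinfun_componentwise)
    fix i :: "real^'d"
    have "continuous_on (ball x0 e) (\<lambda>x. \<pi> (\<tau>' x i) + \<Lambda> i)"
      by (intro continuous_intros bounded_linear.continuous_on[OF bpi] cont)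
    thus "continuous_on (ball x0 e) (\<lambda>x. blinfun_apply (D x) i)"
      by (rule continuous_on_eq) (simp add: D \<Psi>'_def)
  qed
  have x0e: "x0 \<in> ball x0 e" using e by simp
  have linD: "linear (\<Psi>' x0)" using bl'[OF x0e] by (rule bounded_linear.linear)
  \<comment> \<open>Applying \<pi> separates the two summands, because it is idempotent and
    annihilates the values of \<Lambda>. The vanishing of the second places \<open>v\<close> in the
    plane, where transversality applies to the first.\<close>
  have ker: "v = 0" if "\<Psi>' x0 v = 0" for v
  proof -
    have "\<pi> (\<pi> (\<tau>' x0 v) + \<Lambda> v) = 0" using that by (simp add: \<Psi>'_def)
    hence 1: "\<pi> (\<tau>' x0 v) = 0" by (simp add: \<pi>.add idem piL)
    hence "\<Lambda> v = 0" using that by (simp add: \<Psi>'_def)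
    hence "v \<in> coordinate_plane K" by (simp add: kL)
    hence "\<tau>' x0 v = 0" using 1 tan trans by blast
    moreover have "\<tau>' x0 0 = 0"
      using der[OF x0e] by (simp add: has_derivative_bounded_linear linear_simps(3))
    ultimately show "v = 0" using inj0 by (metis injD)
  qed
  have "inj (\<Psi>' x0)" using linD ker by (simp add: linear_injective_0)
  then obtain g where g: "linear g" "g \<circ> \<Psi>' x0 = id"
    using linear_injective_left_inverse[OF linD] by blast
  define G where "G = Blinfun g"
  have "blinfun_apply G = g"
    unfolding G_def using g(1) bounded_linear_Blinfun_apply linear_conv_bounded_linear by blast
  hence "G o\<^sub>L D x0 = id_blinfun"
    using g(2) by (intro blinfun_eqI) (simp add: D[OF x0e] fun_eq_iff)
  then obtain U V \<sigma> \<sigma>' where UV: "open U" "U \<subseteq> ball x0 e" "x0 \<in> U" "open V" "\<Psi> x0 \<in> V"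
    "homeomorphism U V \<Psi> \<sigma>" and d\<sigma>: "\<And>y. y \<in> V \<Longrightarrow> (\<sigma> has_derivative \<sigma>' y) (at y)"
    using inverse_function_theorem[OF open_ball derP contD x0e] by metis
  have P0: "\<Psi> x0 = \<pi> (\<tau> x0)" using x0 kL by (simp add: \<Psi>_def)
  obtain \<rho> where \<rho>: "\<rho> > 0" "ball (\<pi> (\<tau> x0)) \<rho> \<subseteq> V"
    using UV(4,5) P0 open_contains_ball by metis
  have \<sigma>U: "\<sigma> y \<in> U" "\<Psi> (\<sigma> y) = y" if "y \<in> V" for y
    using UV(6) that by (auto simp: homeomorphism_def)
  have pt: "\<pi> (\<tau> (\<sigma> y)) = \<pi> y" if "y \<in> V" for y
    using arg_cong[OF \<sigma>U(2)[OF that], of \<pi>] by (simp add: \<Psi>_def \<pi>.add idem piL)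
  \<comment> \<open>Hence \<Lambda> measures how far \<open>y\<close> is from being fixed by \<pi>:
    over fixed points of \<pi> the inverse lands in the slice. Differentiating this identity gives
    the same statement for \<sigma>'.\<close>
  have L: "\<Lambda> (\<sigma> y) = y - \<pi> y" if "y \<in> V" for y
    using \<sigma>U(2)[OF that] pt[OF that] unfolding \<Psi>_def by (simp add: algebra_simps)
  show thesis
  proof (rule that[of \<rho> \<sigma> \<sigma>'])
    show "0 < \<rho>" by (rule \<rho>)
    show "\<sigma> (\<pi> (\<tau> x0)) = x0" using UV(3,6) P0 by (metis homeomorphism_apply1)
  next
    fix y assume y: "y \<in> ball (\<pi> (\<tau> x0)) \<rho>"
    hence yV: "y \<in> V" using \<rho> by auto
    show "\<sigma> y \<in> ball x0 e" using \<sigma>U(1)[OF yV] UV(2) by blast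
    show "\<pi> (\<tau> (\<sigma> y)) = \<pi> y" using pt yV .
    show "\<sigma> y \<in> coordinate_plane K" if "\<pi> y = y"
      using L[OF yV] that kL by simp
    show d: "(\<sigma> has_derivative \<sigma>' y) (at y)" using d\<sigma> yV .
    have 1: "((\<lambda>y. \<Lambda> (\<sigma> y)) has_derivative (\<lambda>v. \<Lambda> (\<sigma>' y v))) (at y)"
      by (rule bounded_linear.has_derivative[OF bL d])
    have "((\<lambda>y. y - \<pi> y) has_derivative (\<lambda>v. v - \<pi> v)) (at y)"
      by (intro has_derivative_diff has_derivative_ident bounded_linear_imp_has_derivative bpi)
    hence 2: "((\<lambda>y. \<Lambda> (\<sigma> y)) has_derivative (\<lambda>v. v - \<pi> v)) (at y)"
      by (rule has_derivative_transform_within_open[OF _ UV(4) yV]) (simp add: L)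
    show "\<sigma>' y v \<in> coordinate_plane K" if "\<pi> v = v" for v
      using fun_cong[OF has_derivative_unique[OF 1 2], of v] that kL by simp
  qed
qed

section \<open>Comparison of two slices over a common projection\<close>

text \<open>The combinations of the family form a subspace containing it. Indexing by
  \<open>I\<close> instead of the image keeps coefficients of different frames comparable and asks
  for no injectivity of \<open>f\<close>.\<close>

lemma in_span_image_sum:
  assumes "finite I" and "v \<in> span (f ` I)"
  obtains a where "v = (\<Sum>i\<in>I. a i *\<^sub>R f i)"
proof -
  let ?S = "{v. \<exists>a. v = (\<Sum>i\<in>I. a i *\<^sub>R f i)}"
  have "subspace ?S"
    unfolding subspace_def
  proof (intro conjI ballI allI)
    show "0 \<in> ?S" by (auto intro!: exI[of _ "\<lambda>_. 0"])
    show "x + y \<in> ?S" if xy: "x \<in> ?S" "y \<in> ?S" for x y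
    proof -
      from xy obtain a b where "x = (\<Sum>i\<in>I. a i *\<^sub>R f i)" "y = (\<Sum>i\<in>I. b i *\<^sub>R f i)" by blast
      thus ?thesis by (auto intro!: exI[of _ "\<lambda>i. a i + b i"] simp: scaleR_add_left sum.distrib)
    qed
    show "c *\<^sub>R x \<in> ?S" if x: "x \<in> ?S" for c x
    proof -
      from x obtain a where "x = (\<Sum>i\<in>I. a i *\<^sub>R f i)" by blast
      thus ?thesis by (auto intro!: exI[of _ "\<lambda>i. c * a i"] simp: scaleR_sum_right)
    qed
  qed
  moreover have "f ` I \<subseteq> ?S"
  proof (rule image_subsetI)
    fix i assume i: "i \<in> I"
    have "(\<Sum>j\<in>I. (if j = i then 1 else 0) *\<^sub>R f j) = (\<Sum>j\<in>I. if j = i then f j else 0)"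
      by (intro sum.cong) auto
    also have "\<dots> = f i" using i assms(1) by (simp add: sum.delta)
    finally show "f i \<in> ?S" by (auto intro!: exI[of _ "\<lambda>j. if j = i then 1 else 0"])
  qed
  ultimately have "span (f ` I) \<subseteq> ?S" by (intro span_minimal)
  thus thesis using assms(2) that by blast
qed

text \<open>With coefficients \<open>a\<close> of \<open>u\<close> and \<open>b\<close> of
  \<open>v\<close>, the difference splits into the change of frame, \<open>w\<close>, and the change
  of coefficients, \<open>d\<close>. The first is small by \<open>YZ\<close>. Since \<open>u\<close>
  and \<open>v\<close> have equal projections, \<pi> d = - \<pi> w, so the coefficient bound for
  \<open>Z\<close> makes \<open>a - b\<close> small as well.\<close>

lemma frame_vectors_difference:
  fixes Y Z :: "nat \<Rightarrow> 'a::real_normed_vector" and \<pi> :: "'a \<Rightarrow> 'a"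
  assumes lin: "linear \<pi>" and P: "0 \<le> P" "\<And>v. norm (\<pi> v) \<le> P * norm v" and C: "0 \<le> C" and M: "0 \<le> M" and W: "0 \<le> W"
    and Y: "\<And>a. (\<Sum>i<m. \<bar>a i\<bar>) \<le> C * norm (\<pi> (\<Sum>i<m. a i *\<^sub>R Y i))"
    and Z: "\<And>a. (\<Sum>i<m. \<bar>a i\<bar>) \<le> C * norm (\<pi> (\<Sum>i<m. a i *\<^sub>R Z i))"
    and ZM: "\<And>i. i < m \<Longrightarrow> norm (Z i) \<le> M"
    and YZ: "\<And>i. i < m \<Longrightarrow> norm (Y i - Z i) \<le> W"
    and u: "u \<in> span (Y ` {..<m})" and v: "v \<in> span (Z ` {..<m})" and uv: "\<pi> u = \<pi> v"
  shows "norm (u - v) \<le> C * norm (\<pi> u) * (1 + C * P * M) * W"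
proof -
  interpret \<pi>: linear \<pi> by (rule lin)
  obtain a where a: "u = (\<Sum>i<m. a i *\<^sub>R Y i)" using in_span_image_sum[OF _ u] by blast
  obtain b where b: "v = (\<Sum>i<m. b i *\<^sub>R Z i)" using in_span_image_sum[OF _ v] by blast
  define S where "S = (\<Sum>i<m. \<bar>a i\<bar>)"
  define w where "w = (\<Sum>i<m. a i *\<^sub>R (Y i - Z i))"
  define d where "d = (\<Sum>i<m. (a i - b i) *\<^sub>R Z i)"
  have S: "S \<le> C * norm (\<pi> u)" unfolding S_def a by (rule Y)
  have uvd: "u - v = w + d"
    unfolding a b w_def d_def sum.distrib[symmetric] sum_subtractf[symmetric] by (intro sum.cong) (auto simp: algebra_simps)
  have w: "norm w \<le> S * W" unfolding w_def S_def sum_distrib_right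
    by (intro order_trans[OF norm_sum] sum_mono) (auto intro!: mult_left_mono YZ)
  have "\<pi> w + \<pi> d = 0" using arg_cong[OF uvd, of \<pi>] uv by (simp add: \<pi>.add \<pi>.diff)
  hence "norm (\<pi> d) = norm (\<pi> w)" by (metis add_eq_0_iff norm_minus_cancel)
  also have "\<dots> \<le> P * (S * W)" using P(2)[of w] w P(1) by (meson mult_left_mono order_trans)
  finally have "C * norm (\<pi> d) \<le> C * (P * (S * W))" using C by (rule mult_left_mono)
  hence ab: "(\<Sum>i<m. \<bar>a i - b i\<bar>) \<le> C * (P * (S * W))"
    using Z[of "\<lambda>i. a i - b i"] unfolding d_def by linarith
  have "norm d \<le> (\<Sum>i<m. \<bar>a i - b i\<bar>) * M" unfolding d_def sum_distrib_right
    by (intro order_trans[OF norm_sum] sum_mono) (auto intro!: mult_left_mono ZM)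
  also have "\<dots> \<le> C * (P * (S * W)) * M" using ab M by (rule mult_right_mono)
  finally have "norm (u - v) \<le> S * W + C * (P * (S * W)) * M"
    using norm_triangle_ineq[of w d] w uvd by simp
  also have "\<dots> = S * ((1 + C * P * M) * W)" by (simp add: algebra_simps)
  also have "\<dots> \<le> C * norm (\<pi> u) * ((1 + C * P * M) * W)"
    using S C P M W by (intro mult_right_mono) auto
  finally show ?thesis by (simp add: mult.assoc)
qed

text \<open>A point of the first slice is joined to \<open>x1\<close> by a segment inside the slice,
  and the image curve is projected by \<pi> and lifted to the second slice by
  \<open>slice_section\<close>. Both velocities lie in \<open>F\<close>, at two points of the same
  fibre of \<pi>, and have equal projections, so \<open>frame_vectors_difference\<close> turns the
  bound on \<open>X\<close> into the inequality of \<open>osgood_zero\<close>.\<close>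

lemma integral_slices_coincide:
  fixes \<pi> :: "real^'d::finite \<Rightarrow> real^'d" and X :: "nat \<Rightarrow> real^'d \<Rightarrow> real^'d"
  assumes par1: "slice_parametrization F K1 \<tau>1 \<tau>1' x1 e1"
    and par2: "slice_parametrization F K2 \<tau>2 \<tau>2' x2 e2"
    and z01: "\<tau>1 x1 = z0" and z02: "\<tau>2 x2 = z0"
    and lin: "linear \<pi>" and idem: "\<And>v. \<pi> (\<pi> v) = \<pi> v"
    and dim: "card K2 + dim {v. \<pi> v = 0} = CARD('d)"
    and trans: "\<And>v. v \<in> F z0 \<Longrightarrow> \<pi> v = 0 \<Longrightarrow> v = 0"
    and D: "open D" "z0 \<in> D"
    and F: "\<And>z. z \<in> D \<Longrightarrow> F z = span ((\<lambda>i. X i z) ` {..<m})"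
    and inj: "inj_on (\<lambda>i. X i z0) {..<m}" and ind: "independent ((\<lambda>i. X i z0) ` {..<m})"
    and cont: "\<And>i. i < m \<Longrightarrow> continuous_on D (X i)"
    and L: "0 \<le> L" "\<And>i z z'. i < m \<Longrightarrow> z \<in> D \<Longrightarrow> z' \<in> D \<Longrightarrow> z \<noteq> z' \<Longrightarrow> \<pi> z = \<pi> z' \<Longrightarrow>
          norm (X i z - X i z') \<le> L * (norm (z - z') * ln (1 / norm (z - z')))"
  obtains \<eta> where "0 < \<eta>"
    "\<And>x. x \<in> ball x1 \<eta> \<inter> coordinate_plane K1 \<Longrightarrow> \<exists>y\<in>ball x2 e2 \<inter> coordinate_plane K2. \<tau>2 y = \<tau>1 x"
proof -
  interpret \<pi>: linear \<pi> by (rule lin)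
  have bpi: "bounded_linear \<pi>" using lin by (rule linear_conv_bounded_linear[THEN iffD1])
  have e1: "0 < e1" and x1: "x1 \<in> coordinate_plane K1"
    and der1: "\<And>x. x \<in> ball x1 e1 \<Longrightarrow> (\<tau>1 has_derivative \<tau>1' x) (at x)"
    and cont1: "\<And>v. continuous_on (ball x1 e1) (\<lambda>x. \<tau>1' x v)"
    and tan1: "\<And>x v. x \<in> ball x1 e1 \<Longrightarrow> x \<in> coordinate_plane K1 \<Longrightarrow> v \<in> coordinate_plane K1 \<Longrightarrow> \<tau>1' x v \<in> F (\<tau>1 x)"
    using par1 unfolding slice_parametrization_def by auto
  have e2: "0 < e2"
    and der2: "\<And>x. x \<in> ball x2 e2 \<Longrightarrow> (\<tau>2 has_derivative \<tau>2' x) (at x)"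
    and tan2: "\<And>x v. x \<in> ball x2 e2 \<Longrightarrow> x \<in> coordinate_plane K2 \<Longrightarrow> v \<in> coordinate_plane K2 \<Longrightarrow> \<tau>2' x v \<in> F (\<tau>2 x)"
    using par2 unfolding slice_parametrization_def by auto
  have trans2: "v = 0" if "v \<in> F (\<tau>2 x2)" "\<pi> v = 0" for v
    using trans that by (simp add: z02)
  obtain \<rho> \<sigma> \<sigma>' where "0 < \<rho>" and \<sigma>0: "\<sigma> (\<pi> z0) = x2"
    and \<sigma>ball: "\<And>y. y \<in> ball (\<pi> z0) \<rho> \<Longrightarrow> \<sigma> y \<in> ball x2 e2"
    and \<sigma>sec: "\<And>y. y \<in> ball (\<pi> z0) \<rho> \<Longrightarrow> \<pi> (\<tau>2 (\<sigma> y)) = \<pi> y"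
    and \<sigma>plane: "\<And>y. y \<in> ball (\<pi> z0) \<rho> \<Longrightarrow> \<pi> y = y \<Longrightarrow> \<sigma> y \<in> coordinate_plane K2"
    and \<sigma>der: "\<And>y. y \<in> ball (\<pi> z0) \<rho> \<Longrightarrow> (\<sigma> has_derivative \<sigma>' y) (at y)"
    and \<sigma>'plane: "\<And>y v. y \<in> ball (\<pi> z0) \<rho> \<Longrightarrow> \<pi> v = v \<Longrightarrow> \<sigma>' y v \<in> coordinate_plane K2"
    by (rule slice_section[OF par2 lin idem dim trans2, unfolded z02]) auto
  have contz0: "isCont (X i) z0" if "i < m" for i
    using cont[OF that] D by (simp add: continuous_on_eq_continuous_at)
  have ker0: "v = 0" if "v \<in> span ((\<lambda>i. X i z0) ` {..<m})" "\<pi> v = 0" for v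
    using trans that by (simp add: F D)
  obtain C \<epsilon>1 where C: "0 < C" and \<epsilon>1: "0 < \<epsilon>1"
    and Cb: "\<And>z a. dist z z0 < \<epsilon>1 \<Longrightarrow> (\<Sum>i<m. \<bar>a i\<bar>) \<le> C * norm (\<pi> (\<Sum>i<m. a i *\<^sub>R X i z))"
    by (rule frame_coefficients_bound[OF contz0 inj ind lin ker0]) auto
  obtain P where P: "P > 0" "\<And>v. norm (\<pi> v) \<le> P * norm v"
    using linear_bounded_pos[OF lin] by blast
  \<comment> \<open>The surplus 1 makes the bound strict at \<open>z0\<close>, so it persists in a
    neighbourhood.\<close>
  define M where "M = (\<Sum>i<m. norm (X i z0) + 1)"
  have M: "0 \<le> M" unfolding M_def by (intro sum_nonneg) simp
  have XM: "norm (X i z0) + 1 \<le> M" if "i < m" for i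
    unfolding M_def using that by (intro member_le_sum) auto
  have "\<forall>\<^sub>F z in nhds z0. \<forall>i\<in>{..<m}. norm (X i z) < M"
  proof (intro eventually_ball_finite ballI)
    fix i assume i: "i \<in> {..<m}"
    have "((\<lambda>z. norm (X i z)) \<longlongrightarrow> norm (X i z0)) (nhds z0)"
      using contz0[of i] i by (intro tendsto_norm) (simp add: isCont_def tendsto_at_iff_tendsto_nhds)
    thus "\<forall>\<^sub>F z in nhds z0. norm (X i z) < M"
      by (rule order_tendstoD) (use XM[of i] i in auto)
  qed simp
  then obtain \<epsilon>2 where \<epsilon>2: "\<epsilon>2 > 0" "\<And>z i. dist z z0 < \<epsilon>2 \<Longrightarrow> i < m \<Longrightarrow> norm (X i z) < M"
    unfolding eventually_nhds_metric by auto
  obtain \<epsilon>3 where \<epsilon>3: "\<epsilon>3 > 0" "ball z0 \<epsilon>3 \<subseteq> D" using D open_contains_ball by metis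
  \<comment> \<open>The radii guarantee, in this order, the coefficient bound, the bound
    \<open>M\<close> on the frame, membership in \<open>D\<close>, and distances below
    \<open>exp (-1)\<close> within the ball, as \<open>osgood_zero\<close> requires.\<close>
  define \<epsilon> where "\<epsilon> = min (min \<epsilon>1 \<epsilon>2) (min \<epsilon>3 (exp (-1) / 2))"
  have \<epsilon>: "0 < \<epsilon>" using \<epsilon>1 \<epsilon>2 \<epsilon>3 by (simp add: \<epsilon>_def)
  have small: "norm (z - z') < exp (-1)" if "z \<in> ball z0 \<epsilon>" "z' \<in> ball z0 \<epsilon>" for z z'
    using dist_triangle_half_l[of z z0 "exp (-1)" z'] that by (simp add: \<epsilon>_def dist_norm norm_minus_commute)
  have key: "norm (u - v) \<le> C * norm (\<pi> u) * (1 + C * P * M) * (L * (norm (z - z') * ln (1 / norm (z - z'))))"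
    if z: "z \<in> ball z0 \<epsilon>" "z' \<in> ball z0 \<epsilon>" "z \<noteq> z'" "\<pi> z = \<pi> z'"
      and u: "u \<in> F z" and v: "v \<in> F z'" and uv: "\<pi> u = \<pi> v" for u v z z'
  proof (rule frame_vectors_difference[OF lin _ P(2) _ M])
    have zD: "z \<in> D" "z' \<in> D" using z \<epsilon>3 by (auto simp: \<epsilon>_def subset_iff)
    have "0 \<le> ln (1 / norm (z - z'))"
    proof -
      have "norm (z - z') < 1" using small[OF z(1,2)] by (smt (verit) exp_le_one_iff)
      thus ?thesis using z(3) by (intro ln_ge_zero) (simp add: field_simps)
    qed
    thus "0 \<le> L * (norm (z - z') * ln (1 / norm (z - z')))" using L(1) by simp
    show "norm (X i z - X i z') \<le> L * (norm (z - z') * ln (1 / norm (z - z')))" if "i < m" for i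
      using L(2)[OF that zD z(3,4)] .
    show "norm (X i z') \<le> M" if "i < m" for i
      using \<epsilon>2(2)[of z' i] that z by (simp add: \<epsilon>_def dist_commute)
    show "u \<in> span ((\<lambda>i. X i z) ` {..<m})" "v \<in> span ((\<lambda>i. X i z') ` {..<m})"
      using u v F zD by auto
    show "(\<Sum>i<m. \<bar>a i\<bar>) \<le> C * norm (\<pi> (\<Sum>i<m. a i *\<^sub>R X i z))" for a
      using Cb[of z a] z by (simp add: \<epsilon>_def dist_commute)
    show "(\<Sum>i<m. \<bar>a i\<bar>) \<le> C * norm (\<pi> (\<Sum>i<m. a i *\<^sub>R X i z'))" for a
      using Cb[of z' a] z by (simp add: \<epsilon>_def dist_commute)
  qed (use P C uv in auto)
  \<comment> \<open>\<open>h x\<close> is the point of the second slice in the fibre of \<pi>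
    through \<open>\<tau>1 x\<close>; its continuity at \<open>x1\<close> keeps the lifted curve in
    the ball around \<open>z0\<close>.\<close>
  define h where "h x = \<tau>2 (\<sigma> (\<pi> (\<tau>1 x)))" for x
  have x1e: "x1 \<in> ball x1 e1" "x2 \<in> ball x2 e2" "\<pi> z0 \<in> ball (\<pi> z0) \<rho>" using e1 e2 \<open>0 < \<rho>\<close> by auto
  have c1: "isCont \<tau>1 x1" using has_derivative_continuous[OF der1[OF x1e(1)]] .
  have c2: "isCont (\<lambda>x. \<pi> (\<tau>1 x)) x1"
    by (rule isCont_o2[OF c1]) (rule linear_continuous_at[OF bpi])
  have c3: "isCont h x1"
    unfolding h_def
    by (rule isCont_o2[OF isCont_o2[OF c2]])
      (use has_derivative_continuous[OF der2[OF x1e(2)]] has_derivative_continuous[OF \<sigma>der[OF x1e(3)]] in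
        \<open>simp_all add: z01 \<sigma>0\<close>)
  have h0: "h x1 = z0" by (simp add: h_def z01 \<sigma>0 z02)
  have ev: "\<forall>\<^sub>F x in nhds a. dist (f x) (f a) < r" if "isCont f a" "0 < r"
    for f :: "real^'d \<Rightarrow> real^'d" and a r
    using that by (intro tendstoD) (simp_all add: isCont_def tendsto_at_iff_tendsto_nhds)
  have "\<forall>\<^sub>F x in nhds x1. dist (\<tau>1 x) z0 < \<epsilon> \<and> dist (\<pi> (\<tau>1 x)) (\<pi> z0) < \<rho> \<and> dist (h x) z0 < \<epsilon>"
    using ev[OF c1 \<epsilon>] ev[OF c2 \<open>0 < \<rho>\<close>] ev[OF c3 \<epsilon>] unfolding z01 h0 by eventually_elim auto
  then obtain \<eta>0 where \<eta>0: "\<eta>0 > 0"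
    "\<And>x. dist x x1 < \<eta>0 \<Longrightarrow> \<tau>1 x \<in> ball z0 \<epsilon> \<and> \<pi> (\<tau>1 x) \<in> ball (\<pi> z0) \<rho> \<and> h x \<in> ball z0 \<epsilon>"
    unfolding eventually_nhds_metric by (auto simp: dist_commute)
  show thesis
  proof (rule that[of "min e1 \<eta>0"])
    show "0 < min e1 \<eta>0" using e1 \<eta>0 by simp
    fix x assume x: "x \<in> ball x1 (min e1 \<eta>0) \<inter> coordinate_plane K1"
    define l where "l t = x1 + t *\<^sub>R (x - x1)" for t :: real
    define \<gamma>' where "\<gamma>' t = \<tau>1' (l t) (x - x1)" for t
    have l: "l t \<in> ball x1 e1" "dist (l t) x1 < \<eta>0" "l t \<in> coordinate_plane K1" if "t \<in> {0..1}" for t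
    proof -
      have "norm (t *\<^sub>R (x - x1)) \<le> norm (x - x1)" using that by (simp add: mult_left_le_one_le)
      thus "l t \<in> ball x1 e1" "dist (l t) x1 < \<eta>0"
        using x by (auto simp: l_def dist_norm norm_minus_commute)
      show "l t \<in> coordinate_plane K1" using x x1 unfolding l_def
        by (intro subspace_add subspace_scale subspace_diff subspace_coordinate_plane) auto
    qed
    have v: "x - x1 \<in> coordinate_plane K1"
      using x x1 by (intro subspace_diff subspace_coordinate_plane) auto
    have dl: "(l has_vector_derivative (x - x1)) (at t within {0..1})" for t
      unfolding l_def by (auto intro!: derivative_eq_intros)
    have d1: "((\<lambda>t. \<tau>1 (l t)) has_vector_derivative \<gamma>' t) (at t within {0..1})" if t: "t \<in> {0..1}" for t
      unfolding \<gamma>'_def using vector_derivative_diff_chain_within[OF dl has_derivative_at_withinI[OF der1[OF l(1)[OF t]]]]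
      by (simp add: comp_def)
    define y where "y t = \<pi> (\<tau>1 (l t))" for t
    have y: "y t \<in> ball (\<pi> z0) \<rho>" "\<pi> (y t) = y t" if "t \<in> {0..1}" for t
      using \<eta>0(2)[of "l t"] l[OF that] by (auto simp: y_def idem)
    have dy: "(y has_vector_derivative \<pi> (\<gamma>' t)) (at t within {0..1})" if t: "t \<in> {0..1}" for t
      unfolding y_def by (rule bounded_linear.has_vector_derivative[OF bpi d1[OF t]])
    \<comment> \<open>The chain rule form matters: \<open>\<sigma>'plane\<close> puts the inner
      vector into the coordinate plane, and \<open>tan2\<close> then places \<delta>' in
      \<open>F\<close>.\<close>
    define \<delta>' where "\<delta>' t = \<tau>2' (\<sigma> (y t)) (\<sigma>' (y t) (\<pi> (\<gamma>' t)))" for t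
    have d\<sigma>: "((\<lambda>t. \<sigma> (y t)) has_vector_derivative \<sigma>' (y t) (\<pi> (\<gamma>' t))) (at t within {0..1})"
      if t: "t \<in> {0..1}" for t
      using vector_derivative_diff_chain_within[OF dy[OF t] has_derivative_at_withinI[OF \<sigma>der[OF y(1)[OF t]]]]
      by (simp add: comp_def)
    have d2: "((\<lambda>t. \<tau>2 (\<sigma> (y t))) has_vector_derivative \<delta>' t) (at t within {0..1})"
      if t: "t \<in> {0..1}" for t
      unfolding \<delta>'_def
      using vector_derivative_diff_chain_within[OF d\<sigma>[OF t] has_derivative_at_withinI[OF der2[OF \<sigma>ball[OF y(1)[OF t]]]]]
      by (simp add: comp_def)
    have h: "\<tau>2 (\<sigma> (y t)) = h (l t)" for t by (simp add: h_def y_def)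
    have pi2: "\<pi> (\<tau>2 (\<sigma> (y t))) = y t" if "t \<in> {0..1}" for t using \<sigma>sec y that by simp
    have "((\<lambda>t. \<pi> (\<tau>2 (\<sigma> (y t)))) has_vector_derivative \<pi> (\<delta>' t)) (at t within {0..1})"
      if t: "t \<in> {0..1}" for t
      by (rule bounded_linear.has_vector_derivative[OF bpi d2[OF t]])
    hence dy2: "(y has_vector_derivative \<pi> (\<delta>' t)) (at t within {0..1})" if t: "t \<in> {0..1}" for t
      using has_vector_derivative_transform[OF t, of y "\<lambda>t. \<pi> (\<tau>2 (\<sigma> (y t)))"] pi2 t by auto
    \<comment> \<open>Both sides are derivatives of the common projected curve
      \<open>y\<close>.\<close>
    have pieq: "\<pi> (\<gamma>' t) = \<pi> (\<delta>' t)" if t: "t \<in> {0..1}" for t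
      using vector_derivative_unique_within_closed_interval[of 0 1 t y] dy[OF t] dy2[OF t] t by auto
    have "continuous_on {0..1} (\<lambda>t. \<pi> (\<gamma>' t))"
      unfolding \<gamma>'_def
      by (intro bounded_linear.continuous_on[OF bpi] continuous_on_compose2[OF cont1])
        (use l in \<open>auto simp: l_def intro!: continuous_intros\<close>)
    hence "bounded ((\<lambda>t. \<pi> (\<gamma>' t)) ` {0..1})"
      by (intro compact_imp_bounded compact_continuous_image compact_Icc)
    then obtain N where N: "N > 0" "\<And>t. t \<in> {0..1} \<Longrightarrow> norm (\<pi> (\<gamma>' t)) \<le> N"
      unfolding bounded_pos by blast
    define f where "f t = \<tau>1 (l t) - \<tau>2 (\<sigma> (y t))" for t
    \<comment> \<open>\<open>N\<close> bounds the speed of the projected curve; the other factors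
      are the constant of \<open>frame_vectors_difference\<close> and the constant \<open>L\<close>
      of the frame.\<close>
    have "f 1 = 0"
    proof (rule osgood_zero[where C = "C * N * (1 + C * P * M) * L"])
      show "f 0 = 0" by (simp add: f_def l_def y_def z01 \<sigma>0 z02)
      fix t :: real assume t: "t \<in> {0..1}"
      show "(f has_vector_derivative (\<gamma>' t - \<delta>' t)) (at t within {0..1})"
        unfolding f_def by (intro has_vector_derivative_diff d1 d2 t)
      have zz: "\<tau>1 (l t) \<in> ball z0 \<epsilon>" "\<tau>2 (\<sigma> (y t)) \<in> ball z0 \<epsilon>"
        using \<eta>0(2)[OF l(2)[OF t]] h by auto
      show "norm (f t) < exp (- 1)" unfolding f_def by (rule small[OF zz])
      assume ft: "f t \<noteq> 0"
      have in1: "\<gamma>' t \<in> F (\<tau>1 (l t))" unfolding \<gamma>'_def using tan1 l t v by blast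
      have in2: "\<delta>' t \<in> F (\<tau>2 (\<sigma> (y t)))" unfolding \<delta>'_def
        using y t by (intro tan2 \<sigma>ball \<sigma>plane \<sigma>'plane) (auto simp: idem)
      have "norm (\<gamma>' t - \<delta>' t) \<le> C * norm (\<pi> (\<gamma>' t)) * (1 + C * P * M) * (L * (norm (f t) * ln (1 / norm (f t))))"
        unfolding f_def
      proof (rule key[OF zz _ _ in1 in2 pieq[OF t]])
        show "\<tau>1 (l t) \<noteq> \<tau>2 (\<sigma> (y t))" using ft by (simp add: f_def)
        show "\<pi> (\<tau>1 (l t)) = \<pi> (\<tau>2 (\<sigma> (y t)))" using pi2[OF t] by (simp add: y_def)
      qed
      also have "\<dots> \<le> C * N * (1 + C * P * M) * (L * (norm (f t) * ln (1 / norm (f t))))"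
      proof (intro mult_right_mono mult_left_mono N(2) t)
        have "norm (f t) < exp (-1)" unfolding f_def by (rule small[OF zz])
        also have "\<dots> < 1" by simp
        finally have "0 \<le> ln (1 / norm (f t))" using ft by (intro ln_ge_zero) (simp add: field_simps)
        thus "0 \<le> L * (norm (f t) * ln (1 / norm (f t)))" using L(1) by simp
      qed (use C P M in auto)
      finally show "norm (\<gamma>' t - \<delta>' t) \<le> C * N * (1 + C * P * M) * L * (norm (f t) * ln (1 / norm (f t)))"
        by (simp add: mult.assoc)
    qed
    moreover have "l 1 = x" by (simp add: l_def)
    ultimately have "\<tau>2 (\<sigma> (y 1)) = \<tau>1 x" by (simp add: f_def)
    moreover have "\<sigma> (y 1) \<in> ball x2 e2 \<inter> coordinate_plane K2" using y[of 1] \<sigma>ball \<sigma>plane by auto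
    ultimately show "\<exists>y\<in>ball x2 e2 \<inter> coordinate_plane K2. \<tau>2 y = \<tau>1 x" by blast
  qed
qed

section \<open>Integral manifolds in charts\<close>

lemma
  assumes "is_chart c"
  shows is_chart_open: "open (fst c)"
    and is_chart_open_image: "open (snd c ` fst c)"
    and is_chart_continuous: "continuous_on (fst c) (snd c)"
    and is_chart_continuous_inv: "continuous_on (snd c ` fst c) (inv_into (fst c) (snd c))"
    and is_chart_inv: "\<And>p. p \<in> fst c \<Longrightarrow> inv_into (fst c) (snd c) (snd c p) = p"
  using assms by (auto simp: is_chart_def homeomorphism_def)

lemma is_chart_open_image_subset:
  assumes "is_chart c" "open U" "U \<subseteq> fst c"
  shows "open (snd c ` U)"
proof -
  have "openin (top_of_set (snd c ` fst c)) (snd c ` U)"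
    using assms unfolding is_chart_def
    by (intro homeomorphism_imp_open_map) (auto simp: open_subset)
  thus ?thesis using is_chart_open_image[OF assms(1)] by (rule openin_open_trans)
qed

lemma is_chart_open_preimage:
  assumes "is_chart c" "open B"
  shows "open (fst c \<inter> snd c -` B)"
  using continuous_open_preimage[OF is_chart_continuous is_chart_open] assms by blast

lemma is_chart_inj:
  assumes "is_chart c" "p \<in> fst c" "q \<in> fst c" "snd c p = snd c q"
  shows "p = q"
  using assms is_chart_inv by metis

section \<open>Coordinate changes and tangent vectors\<close>

lemma transition_apply:
  assumes "is_chart c" "p \<in> fst c"
  shows "transition c d (snd c p) = snd d p"
  using assms by (simp add: transition_def is_chart_inv)

text \<open>On the image of the triple overlap, which is open, the transition from \<open>c\<close>
  to \<open>e\<close> is the composite through \<open>d\<close>. Its differentiability is thus a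
  conclusion, which allows charts to be compared through an intermediate one.\<close>

lemma transition_chain:
  assumes c: "is_chart c" and d: "is_chart d" and e: "is_chart e"
    and q: "q \<in> fst c" "q \<in> fst d" "q \<in> fst e"
    and cd: "transition c d differentiable (at (snd c q))"
    and de: "transition d e differentiable (at (snd d q))"
  shows "(transition c e has_derivative (\<lambda>v. frechet_derivative (transition d e) (at (snd d q))
           (frechet_derivative (transition c d) (at (snd c q)) v))) (at (snd c q))"
proof -
  have 1: "(transition c d has_derivative frechet_derivative (transition c d) (at (snd c q))) (at (snd c q))"
    using cd frechet_derivative_works by blast
  have 2: "(transition d e has_derivative frechet_derivative (transition d e) (at (snd d q)))
      (at (transition c d (snd c q)))"
    using de frechet_derivative_works transition_apply[OF c q(1)] by metis
  have "open (snd c ` (fst c \<inter> fst d \<inter> fst e))"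
    using c d e by (intro is_chart_open_image_subset open_Int is_chart_open) auto
  moreover have "snd c q \<in> snd c ` (fst c \<inter> fst d \<inter> fst e)" using q by blast
  moreover have "transition d e (transition c d x) = transition c e x"
    if "x \<in> snd c ` (fst c \<inter> fst d \<inter> fst e)" for x
    using that c d by (auto simp: transition_apply)
  ultimately show ?thesis
    using has_derivative_transform_within_open[OF has_derivative_compose[OF 1 2]] by blast
qed

lemma transition_self_derivative:
  assumes "is_chart c" "q \<in> fst c"
  shows "(transition c c has_derivative (\<lambda>v. v)) (at (snd c q))"
  by (rule has_derivative_transform_within_open[OF has_derivative_ident is_chart_open_image[OF assms(1)]])
    (use assms in \<open>auto simp: transition_apply\<close>)

lemma compatible_C1:
  assumes "compatible r c d" "1 \<le> r"
  shows "Ck_on (Suc 0) (transition c d) (snd c ` (fst c \<inter> fst d))"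
    and "Ck_on (Suc 0) (transition d c) (snd d ` (fst c \<inter> fst d))"
  using assms one_enat_def unfolding compatible_def Cr_on_def by (metis One_nat_def)+

text \<open>In finite dimension, continuity for each fixed vector gives joint continuity: expand the
  argument in the basis.\<close>

lemma continuous_on_apply_linear:
  fixes f :: "'a::topological_space \<Rightarrow> 'b::euclidean_space \<Rightarrow> 'c::real_normed_vector"
  assumes "\<And>v. continuous_on S (\<lambda>x. f x v)" "\<And>x. x \<in> S \<Longrightarrow> linear (f x)" "continuous_on S g"
  shows "continuous_on S (\<lambda>x. f x (g x))"
proof -
  have "continuous_on S (\<lambda>x. \<Sum>b\<in>Basis. (g x \<bullet> b) *\<^sub>R f x b)"
    by (intro continuous_intros assms)
  moreover have "(\<Sum>b\<in>Basis. (g x \<bullet> b) *\<^sub>R f x b) = f x (g x)" if "x \<in> S" for x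
  proof -
    interpret linear "f x" using assms(2) that .
    show ?thesis by (simp add: sum[symmetric] scaleR[symmetric] euclidean_representation)
  qed
  ultimately show ?thesis by (rule continuous_on_eq)
qed

text \<open>Near a common point the transition factors through a chart of \<open>A\<close>, which
  depends on the point, so the claim is proved locally. Two exponents are allowed because slice
  charts belong to the \<open>C\<^sup>1\<close> structure, whereas the bundle is seen in charts of
  class \<open>C\<^sup>r\<close>.\<close>

lemma max_atlas_transition_C1:
  assumes A: "\<forall>a\<in>A. is_chart a"
    and c: "c \<in> max_atlas r A" and d: "d \<in> max_atlas s A" and rs: "1 \<le> r" "1 \<le> s"
  shows "\<And>q. q \<in> fst c \<Longrightarrow> q \<in> fst d \<Longrightarrow> transition c d differentiable (at (snd c q))"
    and "\<And>v. continuous_on (snd c ` (fst c \<inter> fst d)) (\<lambda>x. frechet_derivative (transition c d) (at x) v)"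
proof -
  have cc: "is_chart c" "is_chart d" using c d by (auto simp: max_atlas_def)
  have loc: "transition c d differentiable (at (snd c q)) \<and>
      isCont (\<lambda>x. frechet_derivative (transition c d) (at x) v) (snd c q)"
    if q: "q \<in> fst c" "q \<in> fst d" for q v
  proof -
    obtain a where a: "a \<in> A" "q \<in> fst a"
      using c q by (auto simp: max_atlas_def carrier_of_def)
    have ac: "is_chart a" using a A by blast
    have "compatible r c a" "compatible s d a" using a c d by (auto simp: max_atlas_def)
    note C1 = compatible_C1(1)[OF this(1) rs(1)] compatible_C1(2)[OF this(2) rs(2)]
    define S where "S = fst c \<inter> fst d \<inter> fst a"
    have oS: "open (snd c ` S)" unfolding S_def using cc ac
      by (intro is_chart_open_image_subset open_Int is_chart_open) auto
    have qS: "snd c q \<in> snd c ` S" using q a by (auto simp: S_def)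
    have d1: "transition c a differentiable (at (snd c x))" if "x \<in> S" for x
      using C1(1) that by (auto simp: S_def)
    have d2: "transition a d differentiable (at (snd a x))" if "x \<in> S" for x
      using C1(2) that by (auto simp: S_def)
    have ch: "(transition c d has_derivative (\<lambda>v. frechet_derivative (transition a d) (at (snd a x))
           (frechet_derivative (transition c a) (at (snd c x)) v))) (at (snd c x))" if "x \<in> S" for x
      using transition_chain[OF cc(1) ac cc(2) _ _ _ d1[OF that] d2[OF that]] that by (auto simp: S_def)
    have ct: "continuous_on (snd c ` S) (transition c a)"
      using d1 by (auto intro!: continuous_at_imp_continuous_on differentiable_imp_continuous_within)
    have tS: "transition c a ` (snd c ` S) \<subseteq> snd a ` (fst d \<inter> fst a)"
      using cc by (auto simp: S_def transition_apply)
    have "continuous_on (snd c ` S) (\<lambda>x. frechet_derivative (transition a d) (at (transition c a x))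
           (frechet_derivative (transition c a) (at x) v))"
    proof (rule continuous_on_apply_linear[where f = "\<lambda>x. frechet_derivative (transition a d) (at (transition c a x))"])
      show "continuous_on (snd c ` S) (\<lambda>x. frechet_derivative (transition a d) (at (transition c a x)) v)" for v
        by (rule continuous_on_compose2[OF _ ct tS]) (use C1(2) in auto)
      have "continuous_on (snd c ` (fst c \<inter> fst a)) (\<lambda>x. frechet_derivative (transition c a) (at x) v)"
        using C1(1) by auto
      thus "continuous_on (snd c ` S) (\<lambda>x. frechet_derivative (transition c a) (at x) v)"
        by (rule continuous_on_subset) (auto simp: S_def)
      show "linear (frechet_derivative (transition a d) (at (transition c a x)))" if "x \<in> snd c ` S" for x
        using that d2 cc by (auto simp: S_def transition_apply intro!: linear_frechet_derivative)
    qed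
    hence "continuous_on (snd c ` S) (\<lambda>x. frechet_derivative (transition c d) (at x) v)"
    proof (rule continuous_on_eq)
      fix x assume "x \<in> snd c ` S"
      then obtain y where y: "y \<in> S" "x = snd c y" by blast
      show "frechet_derivative (transition a d) (at (transition c a x)) (frechet_derivative (transition c a) (at x) v)
          = frechet_derivative (transition c d) (at x) v"
        using frechet_derivative_at[OF ch[OF y(1)]] y cc by (auto simp: S_def transition_apply dest: fun_cong)
    qed
    hence "isCont (\<lambda>x. frechet_derivative (transition c d) (at x) v) (snd c q)"
      using continuous_on_eq_continuous_at[OF oS] qS by blast
    moreover have "transition c d differentiable (at (snd c q))"
      using ch[of q] q a unfolding differentiable_def by (auto simp: S_def)
    ultimately show ?thesis by blast
  qed
  show "transition c d differentiable (at (snd c q))" if "q \<in> fst c" "q \<in> fst d" for q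
    using loc that by blast
  show "continuous_on (snd c ` (fst c \<inter> fst d)) (\<lambda>x. frechet_derivative (transition c d) (at x) v)" for v
    using loc by (auto intro!: continuous_at_imp_continuous_on)
qed

text \<open>Transporting \<open>u\<close> out of \<open>c\<close> by the derivatives of the
  transitions defines the other components, and the chain rule is their compatibility. This promotes
  a velocity computed in one chart to an element of \<open>tangent_space\<close>.\<close>

lemma tangent_vector_from_chart:
  assumes A: "\<forall>a\<in>A. is_chart a" and r: "1 \<le> r" and c: "c \<in> charts_at r A q"
  obtains v where "v \<in> tangent_space r A q" "v c = u"
proof -
  define v where "v c' = (if c' \<in> charts_at r A q
      then frechet_derivative (transition c c') (at (snd c q)) u else 0)" for c'
  have ch: "is_chart c'" "c' \<in> max_atlas r A" "q \<in> fst c'" if "c' \<in> charts_at r A q" for c'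
    using that by (auto simp: charts_at_def max_atlas_def)
  have "v d = frechet_derivative (transition c' d) (at (snd c' q)) (v c')"
    if cd: "c' \<in> charts_at r A q" "d \<in> charts_at r A q" for c' d
  proof -
    have "(transition c d has_derivative (\<lambda>v. frechet_derivative (transition c' d) (at (snd c' q))
           (frechet_derivative (transition c c') (at (snd c q)) v))) (at (snd c q))"
      using c cd by (intro transition_chain max_atlas_transition_C1(1)[OF A _ _ r r] ch)
    from fun_cong[OF frechet_derivative_at[OF this], of u] show ?thesis using c cd by (simp add: v_def)
  qed
  moreover have "\<forall>c'. c' \<notin> charts_at r A q \<longrightarrow> v c' = 0" by (simp add: v_def)
  ultimately have "v \<in> tangent_space r A q" unfolding tangent_space_def by blast
  moreover have "v c = u"
    using frechet_derivative_at[OF transition_self_derivative[OF ch(1)[OF c] ch(3)[OF c]], symmetric] c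
    by (simp add: v_def)
  ultimately show thesis by (rule that)
qed

text \<open>The parametrization is the transition from a slice chart to \<open>c\<close>. The last
  conclusion is where embeddedness of \<open>N\<close> enters: every point of \<open>N\<close> close
  to \<open>p\<close> comes from an arbitrarily small piece of this one slice.\<close>

lemma integral_manifold_slice_parametrization:
  fixes A :: "('a::{t2_space,second_countable_topology}, 'd::finite) chart set"
  assumes r: "1 \<le> r" and A: "Cr_atlas r A" and c: "c \<in> charts_at r A p"
    and N: "integral_manifold r A m E N" and p: "p \<in> N"
  obtains K \<tau> \<tau>' x0 e where "card K = m"
    "slice_parametrization (\<lambda>z. components c (E (inv_into (fst c) (snd c) z))) K \<tau> \<tau>' x0 e"
    "\<tau> x0 = snd c p"
    "\<And>x. x \<in> ball x0 e \<inter> coordinate_plane K \<Longrightarrow> \<tau> x \<in> snd c ` (fst c \<inter> N)"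
    "\<And>\<eta>. 0 < \<eta> \<Longrightarrow> \<exists>U. open U \<and> p \<in> U \<and>
       (\<forall>q\<in>N \<inter> U. q \<in> fst c \<and> (\<exists>x\<in>ball x0 \<eta> \<inter> coordinate_plane K. \<tau> x = snd c q))"
proof -
  have Ac: "\<forall>a\<in>A. is_chart a" using A by (auto simp: Cr_atlas_def)
  have "\<exists>d\<in>charts_at 1 A p. \<exists>K. card K = m \<and> snd d ` (fst d \<inter> N) = snd d ` fst d \<inter> coordinate_plane K"
    using N p unfolding integral_manifold_def C1_submanifold_def coordinate_plane_def by simp
  then obtain d K where d: "d \<in> charts_at 1 A p" and K: "card K = m"
    and slice: "snd d ` (fst d \<inter> N) = snd d ` fst d \<inter> coordinate_plane K"
    by auto
  have cm: "c \<in> max_atlas r A" "is_chart c" "p \<in> fst c" using c by (auto simp: charts_at_def max_atlas_def)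
  have dm: "d \<in> max_atlas 1 A" "is_chart d" "p \<in> fst d" using d by (auto simp: charts_at_def max_atlas_def)
  have inN: "q \<in> N \<longleftrightarrow> snd d q \<in> coordinate_plane K" if "q \<in> fst d" for q
    using slice that is_chart_inj[OF dm(2)] by blast
  define \<tau> where "\<tau> = transition d c"
  define \<tau>' where "\<tau>' x = frechet_derivative \<tau> (at x)" for x
  define x0 where "x0 = snd d p"
  define S where "S = snd d ` (fst d \<inter> fst c)"
  have diff: "transition d c differentiable (at (snd d q))" if "q \<in> fst d" "q \<in> fst c" for q
    using max_atlas_transition_C1(1)[OF Ac dm(1) cm(1) _ r that] by simp
  have der: "(\<tau> has_derivative \<tau>' x) (at x)" if "x \<in> S" for x
    using that diff unfolding \<tau>_def \<tau>'_def S_def by (auto simp: frechet_derivative_works[symmetric])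
  have cont: "continuous_on S (\<lambda>x. \<tau>' x v)" for v
    using max_atlas_transition_C1(2)[OF Ac dm(1) cm(1) _ r] unfolding S_def \<tau>_def \<tau>'_def by simp
  have "open S" unfolding S_def using dm cm by (intro is_chart_open_image_subset open_Int is_chart_open) auto
  moreover have "x0 \<in> S" using dm cm by (auto simp: S_def x0_def)
  ultimately obtain e where e: "0 < e" "ball x0 e \<subseteq> S" using open_contains_ball by metis
  have \<tau>: "\<tau> (snd d q) = snd c q" if "q \<in> fst d" for q
    unfolding \<tau>_def by (rule transition_apply[OF dm(2) that])
  have ptN: "\<exists>q. q \<in> fst d \<and> q \<in> fst c \<and> q \<in> N \<and> x = snd d q \<and> \<tau> x = snd c q \<and> inv_into (fst d) (snd d) x = q"
    if "x \<in> ball x0 e \<inter> coordinate_plane K" for x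
    using that e(2) inN is_chart_inv[OF dm(2)] \<tau> unfolding S_def by blast
  \<comment> \<open>By the chain rule for the transition from the slice chart to itself, the
    derivative of the reverse transition is a left inverse.\<close>
  have inj: "inj (\<tau>' x0)"
  proof -
    have "(transition d d has_derivative (\<lambda>v. frechet_derivative (transition c d) (at (snd c p)) (\<tau>' x0 v))) (at x0)"
      unfolding \<tau>'_def \<tau>_def x0_def
      using dm cm diff max_atlas_transition_C1(1)[OF Ac cm(1) dm(1) r] by (intro transition_chain) auto
    moreover have "(transition d d has_derivative (\<lambda>v. v)) (at x0)"
      unfolding x0_def by (rule transition_self_derivative[OF dm(2,3)])
    ultimately have "(\<lambda>v. frechet_derivative (transition c d) (at (snd c p)) (\<tau>' x0 v)) = (\<lambda>v. v)"
      by (rule has_derivative_unique)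
    thus ?thesis by (metis injI)
  qed
  have tan: "\<tau>' x v \<in> components c (E (inv_into (fst c) (snd c) (\<tau> x)))"
    if x: "x \<in> ball x0 e \<inter> coordinate_plane K" and v: "v \<in> coordinate_plane K" for x v
  proof -
    obtain q where q: "q \<in> fst d" "q \<in> fst c" "q \<in> N" "x = snd d q" "\<tau> x = snd c q"
      using ptN[OF x] by blast
    have cq: "c \<in> charts_at r A q" using cm q by (simp add: charts_at_def)
    obtain w where w: "w \<in> tangent_space r A q" "w c = \<tau>' x v"
      using tangent_vector_from_chart[OF Ac r cq] by metis
    \<comment> \<open>A straight line in slice coordinates stays in the plane, so it describes a
      curve in \<open>N\<close> whose velocity in \<open>c\<close> is \<open>\<tau>' x v\<close>.
      Hence \<open>w\<close> is tangent to \<open>N\<close> and lies in \<open>E q\<close>.\<close>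
    define l where "l t = x + t *\<^sub>R v" for t :: real
    have "isCont l 0" unfolding l_def by (intro continuous_intros)
    moreover have "l 0 \<in> ball x0 e" using x by (simp add: l_def)
    ultimately have "\<forall>\<^sub>F t in nhds 0. l t \<in> ball x0 e"
      unfolding isCont_def tendsto_at_iff_tendsto_nhds by (intro topological_tendstoD) auto
    then obtain b where b: "b > 0" "\<And>t. dist t 0 < b \<Longrightarrow> l t \<in> ball x0 e"
      unfolding eventually_nhds_metric by blast
    have lb: "l t \<in> ball x0 e \<inter> coordinate_plane K" if "t \<in> {-b<..<b}" for t
    proof
      show "l t \<in> ball x0 e" using b(2)[of t] that by (auto simp: dist_real_def)
      show "l t \<in> coordinate_plane K" unfolding l_def
        using x v by (intro subspace_add subspace_scale subspace_coordinate_plane) auto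
    qed
    define \<gamma> where "\<gamma> t = inv_into (fst d) (snd d) (l t)" for t
    have g1: "\<gamma> ` {-b<..<b} \<subseteq> N \<inter> fst c"
      using ptN[OF lb] unfolding \<gamma>_def by fastforce
    have g0: "\<gamma> 0 = q" unfolding \<gamma>_def l_def using q is_chart_inv[OF dm(2)] by simp
    have comp: "snd c \<circ> \<gamma> = \<tau> \<circ> l" by (simp add: \<tau>_def transition_def \<gamma>_def fun_eq_iff)
    have dl: "(l has_vector_derivative v) (at t)" for t
      unfolding l_def by (auto intro!: derivative_eq_intros)
    have dg: "(snd c \<circ> \<gamma> has_vector_derivative \<tau>' (l t) v) (at t)" if "t \<in> {-b<..<b}" for t
    proof -
      have "l t \<in> S" using lb[OF that] e by auto
      thus ?thesis unfolding comp
        using vector_derivative_diff_chain_within[OF dl has_derivative_at_withinI[OF der]] by simp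
    qed
    have "continuous_on {-b<..<b} (\<lambda>t. \<tau>' (l t) v)"
      by (rule continuous_on_compose2[OF cont]) (use lb e in \<open>auto simp: l_def intro!: continuous_intros\<close>)
    hence C1: "(snd c \<circ> \<gamma>) C1_differentiable_on {-b<..<b}"
      unfolding C1_differentiable_on_def using dg by (intro exI[of _ "\<lambda>t. \<tau>' (l t) v"] conjI ballI)
    have "(snd c \<circ> \<gamma> has_vector_derivative w c) (at 0)"
      using dg[of 0] b(1) by (simp add: w l_def)
    hence "w \<in> tangent_to r A N q"
      unfolding tangent_to_def mem_Collect_eq
      by (intro conjI bexI[OF _ cq] exI[of _ b] exI[of _ \<gamma>] w(1) b(1) g1 g0 C1)
    hence "w \<in> E q" using N q unfolding integral_manifold_def by blast
    hence "\<tau>' x v \<in> components c (E q)" 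
      unfolding components_def using image_eqI[of "\<tau>' x v" "\<lambda>v. v c" w "E q"] w(2) by simp
    thus ?thesis using q is_chart_inv[OF cm(2)] by simp
  qed
  show thesis
  proof (rule that[of K \<tau> \<tau>' x0 e])
    show "card K = m" by (rule K)
    have x0K: "x0 \<in> coordinate_plane K" using inN[OF dm(3)] p unfolding x0_def by blast
    have der': "\<forall>x\<in>ball x0 e. (\<tau> has_derivative \<tau>' x) (at x)" using der e(2) by blast
    have tan': "\<forall>x\<in>ball x0 e \<inter> coordinate_plane K. \<forall>v\<in>coordinate_plane K.
        \<tau>' x v \<in> components c (E (inv_into (fst c) (snd c) (\<tau> x)))"
      by (intro ballI tan)
    show "slice_parametrization (\<lambda>z. components c (E (inv_into (fst c) (snd c) z))) K \<tau> \<tau>' x0 e"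
      unfolding slice_parametrization_def
      by (intro conjI e(1) x0K inj der' allI tan' continuous_on_subset[OF cont e(2)])
    show "\<tau> x0 = snd c p" unfolding x0_def using \<tau> dm by simp
    show "\<tau> x \<in> snd c ` (fst c \<inter> N)" if "x \<in> ball x0 e \<inter> coordinate_plane K" for x
      using ptN[OF that] by auto
    fix \<eta> :: real assume "0 < \<eta>"
    show "\<exists>U. open U \<and> p \<in> U \<and>
       (\<forall>q\<in>N \<inter> U. q \<in> fst c \<and> (\<exists>x\<in>ball x0 \<eta> \<inter> coordinate_plane K. \<tau> x = snd c q))"
    proof (intro exI[of _ "(fst d \<inter> snd d -` ball x0 \<eta>) \<inter> fst c"] conjI ballI)
      show "open ((fst d \<inter> snd d -` ball x0 \<eta>) \<inter> fst c)"
        by (rule open_Int[OF is_chart_open_preimage[OF dm(2) open_ball] is_chart_open[OF cm(2)]])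
      show "p \<in> (fst d \<inter> snd d -` ball x0 \<eta>) \<inter> fst c" using dm cm \<open>0 < \<eta>\<close> by (simp add: x0_def)
      fix q assume q: "q \<in> N \<inter> ((fst d \<inter> snd d -` ball x0 \<eta>) \<inter> fst c)"
      show "q \<in> fst c" using q by blast
      show "\<exists>x\<in>ball x0 \<eta> \<inter> coordinate_plane K. \<tau> x = snd c q"
        using q inN[of q] \<tau>[of q] by (intro bexI[of _ "snd d q"]) auto
    qed
  qed
qed

text \<open>This carries \<open>integral_slices_coincide\<close> from the chart back to the
  manifold. The projection and \<open>L\<close> stay free, since the two cases of the theorem choose
  them differently; the bound on the frame is asked only along fibres of \<pi>.\<close>

lemma integral_manifold_locally_contained:
  fixes A :: "('a::{t2_space,second_countable_topology}, 'd::finite) chart set"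
    and \<pi> :: "real^'d \<Rightarrow> real^'d"
  assumes r: "1 \<le> r" and A: "Cr_atlas r A" and c: "c \<in> charts_at r A p"
    and N1: "integral_manifold r A m E N1" "p \<in> N1" and N2: "integral_manifold r A m E N2" "p \<in> N2"
    and V: "open V" "p \<in> V" "V \<subseteq> fst c" and X: "local_frame m E c V X"
    and lin: "linear \<pi>" and idem: "\<And>v. \<pi> (\<pi> v) = \<pi> v"
    and dim: "m + dim {v. \<pi> v = 0} = CARD('d)"
    and trans: "\<And>v. v \<in> components c (E p) \<Longrightarrow> \<pi> v = 0 \<Longrightarrow> v = 0"
    and L: "0 \<le> L" "\<And>i q q'. i < m \<Longrightarrow> q \<in> V \<Longrightarrow> q' \<in> V \<Longrightarrow> snd c q \<noteq> snd c q' \<Longrightarrow>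
          \<pi> (snd c q) = \<pi> (snd c q') \<Longrightarrow>
          norm (X i q - X i q') \<le> L * (norm (snd c q - snd c q') * ln (1 / norm (snd c q - snd c q')))"
  shows "\<exists>U. open U \<and> p \<in> U \<and> N1 \<inter> U \<subseteq> N2"
proof -
  let ?inv = "inv_into (fst c) (snd c)"
  let ?F = "\<lambda>z. components c (E (?inv z))"
  have cc: "is_chart c" "p \<in> fst c" using c by (auto simp: charts_at_def max_atlas_def)
  have iV: "?inv (snd c q) = q" if "q \<in> V" for q using is_chart_inv[OF cc(1)] that V by blast
  obtain K1 \<tau>1 \<tau>1' x1 e1 where K1: "card K1 = m"
    and par1: "slice_parametrization ?F K1 \<tau>1 \<tau>1' x1 e1" and t1: "\<tau>1 x1 = snd c p"
    and near1: "\<And>\<eta>. 0 < \<eta> \<Longrightarrow> \<exists>U. open U \<and> p \<in> U \<and>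
       (\<forall>q\<in>N1 \<inter> U. q \<in> fst c \<and> (\<exists>x\<in>ball x1 \<eta> \<inter> coordinate_plane K1. \<tau>1 x = snd c q))"
    by (rule integral_manifold_slice_parametrization[OF r A c N1]) blast
  obtain K2 \<tau>2 \<tau>2' x2 e2 where K2: "card K2 = m"
    and par2: "slice_parametrization ?F K2 \<tau>2 \<tau>2' x2 e2" and t2: "\<tau>2 x2 = snd c p"
    and in2: "\<And>x. x \<in> ball x2 e2 \<inter> coordinate_plane K2 \<Longrightarrow> \<tau>2 x \<in> snd c ` (fst c \<inter> N2)"
    by (rule integral_manifold_slice_parametrization[OF r A c N2]) blast
  have dim2: "card K2 + dim {v. \<pi> v = 0} = CARD('d)" using dim K2 by simp
  obtain \<eta> where \<eta>: "0 < \<eta>"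
    "\<And>x. x \<in> ball x1 \<eta> \<inter> coordinate_plane K1 \<Longrightarrow> \<exists>y\<in>ball x2 e2 \<inter> coordinate_plane K2. \<tau>2 y = \<tau>1 x"
  proof (rule integral_slices_coincide[OF par1 par2 t1 t2 lin idem dim2, where D = "snd c ` V"
        and m = m and X = "\<lambda>i z. X i (?inv z)" and L = L])
    show "v = 0" if "v \<in> ?F (snd c p)" "\<pi> v = 0" for v using trans that iV V by simp
    show "open (snd c ` V)" by (rule is_chart_open_image_subset[OF cc(1) V(1,3)])
    show "snd c p \<in> snd c ` V" using V by blast
    show "?F z = span ((\<lambda>i. X i (?inv z)) ` {..<m})" if "z \<in> snd c ` V" for z
      using X that iV unfolding local_frame_def by auto
    show "inj_on (\<lambda>i. X i (?inv (snd c p))) {..<m}" "independent ((\<lambda>i. X i (?inv (snd c p))) ` {..<m})"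
      using X iV V unfolding local_frame_def by auto
    show "continuous_on (snd c ` V) (\<lambda>z. X i (?inv z))" if "i < m" for i
    proof (rule continuous_on_compose2[where f = ?inv and g = "X i"])
      show "continuous_on V (X i)" using X that unfolding local_frame_def by blast
      show "continuous_on (snd c ` V) ?inv"
        by (rule continuous_on_subset[OF is_chart_continuous_inv[OF cc(1)]]) (use V in blast)
      show "?inv ` (snd c ` V) \<subseteq> V" using iV by auto
    qed
    show "norm (X i (?inv z) - X i (?inv z')) \<le> L * (norm (z - z') * ln (1 / norm (z - z')))"
      if "i < m" "z \<in> snd c ` V" "z' \<in> snd c ` V" "z \<noteq> z'" "\<pi> z = \<pi> z'" for i z z'
      using that L(2)[of i] iV by auto
    show "0 \<le> L" by (rule L(1))
  qed (rule that)
  from near1[OF \<eta>(1)] obtain U where U: "open U" "p \<in> U"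
    "\<forall>q\<in>N1 \<inter> U. q \<in> fst c \<and> (\<exists>x\<in>ball x1 \<eta> \<inter> coordinate_plane K1. \<tau>1 x = snd c q)"
    by (elim exE conjE)
  have "q \<in> N2" if q: "q \<in> N1 \<inter> U" for q
  proof -
    from bspec[OF U(3) q]
    obtain x where x: "q \<in> fst c" "x \<in> ball x1 \<eta> \<inter> coordinate_plane K1" "\<tau>1 x = snd c q"
      by (elim conjE bexE)
    obtain y where y: "y \<in> ball x2 e2 \<inter> coordinate_plane K2" "\<tau>2 y = snd c q"
      using \<eta>(2)[OF x(2)] x(3) by auto
    from in2[OF y(1)] obtain q' where q': "\<tau>2 y = snd c q'" "q' \<in> fst c \<inter> N2" by (elim imageE)
    have "q' = q" using q' x(1) y(2) by (intro is_chart_inj[OF cc(1)]) (blast, blast, metis)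
    thus ?thesis using q'(2) by blast
  qed
  thus ?thesis using U by blast
qed

section \<open>Moduli of continuity\<close>

text \<open>For \<open>s < c\<close> the lower bound on \<open>w1\<close> gives
  \<open>s * s * exp (w2 s / s) < 1\<close>, and taking logarithms yields the claim. Trading the
  constant \<open>c\<close> for a second power of \<open>s\<close> is what produces the factor
  2.\<close>

lemma log_bound_from_exponential_condition:
  assumes I: "{0<..<a} \<subseteq> I" "0 < a" and c: "0 < c" "\<forall>\<^sub>F s in at_right 0. c * s \<le> w1 s"
    and lim: "((\<lambda>s. w1 s * exp (w2 s / s)) \<longlongrightarrow> 0) (at_right 0)"
  obtains s0 :: real where "0 < s0" "\<And>s. 0 < s \<Longrightarrow> s < s0 \<Longrightarrow> s \<in> I \<and> w2 s \<le> 2 * (s * ln (1 / s))"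
proof -
  have "\<forall>\<^sub>F s in at_right 0. w1 s * exp (w2 s / s) < 1"
    using order_tendstoD(2)[OF lim] by simp
  with c(2) have "\<forall>\<^sub>F s in at_right 0. c * s \<le> w1 s \<and> w1 s * exp (w2 s / s) < 1"
    by eventually_elim simp
  then obtain b where b: "b > 0" "\<And>s. 0 < s \<Longrightarrow> s < b \<Longrightarrow> c * s \<le> w1 s \<and> w1 s * exp (w2 s / s) < 1"
    unfolding eventually_at_right_field by auto
  show thesis
  proof (rule that[of "min (min a b) c"])
    show "0 < min (min a b) c" using I b c by simp
    fix s assume s: "0 < s" "s < min (min a b) c"
    have "s * s * exp (w2 s / s) \<le> c * s * exp (w2 s / s)" using s by (intro mult_right_mono) auto
    also have "\<dots> \<le> w1 s * exp (w2 s / s)" using b(2)[of s] s by (intro mult_right_mono) auto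
    also have "\<dots> < 1" using b(2)[of s] s by simp
    finally have "exp (w2 s / s) < (1 / s)\<^sup>2" using s by (simp add: field_simps power2_eq_square)
    hence "w2 s / s < ln ((1 / s)\<^sup>2)" using s by (subst ln_exp[symmetric], subst ln_less_cancel_iff) auto
    also have "\<dots> = 2 * ln (1 / s)" using s by (simp add: ln_realpow)
    finally have "w2 s \<le> 2 * (s * ln (1 / s))" using s by (simp add: field_simps)
    moreover have "s \<in> I" using s I by auto
    ultimately show "s \<in> I \<and> w2 s \<le> 2 * (s * ln (1 / s))" by simp
  qed
qed

text \<open>The coordinates in \<open>J\<close> are changed one at a time, each by at most the
  distance of the two points. Monotonicity of \<open>w\<close> allows the logarithmic bound to be
  applied once, at that distance, and not at the single increments.\<close>

lemma log_lipschitz_along_coordinates: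
  fixes f :: "real^'d::finite \<Rightarrow> real"
  assumes mono: "mono_on I w"
    and s0: "0 < s0" "\<And>s. 0 < s \<Longrightarrow> s < s0 \<Longrightarrow> s \<in> I \<and> w s \<le> 2 * (s * ln (1 / s))"
    and D: "open D" "z0 \<in> D" and f: "\<forall>j\<in>J. modulus_wrt_variable I w j D f"
  shows "\<exists>L\<ge>0. \<exists>e>0. \<forall>z\<in>ball z0 e. \<forall>z'\<in>ball z0 e. (\<forall>i. i \<notin> J \<longrightarrow> z $ i = z' $ i) \<longrightarrow> z \<noteq> z' \<longrightarrow>
      \<bar>f z - f z'\<bar> \<le> L * (norm (z - z') * ln (1 / norm (z - z')))"
proof -
  obtain \<rho> where \<rho>: "\<rho> > 0" "ball z0 \<rho> \<subseteq> D" using D open_contains_ball by metis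
  have "\<forall>j\<in>J. \<exists>K \<delta>. K > 0 \<and> \<delta> > 0 \<and> (\<forall>z s. z \<in> D \<and> z + s *\<^sub>R axis j 1 \<in> D \<and> \<bar>s\<bar> < \<delta> \<and> \<bar>s\<bar> \<in> I \<longrightarrow>
        \<bar>f (z + s *\<^sub>R axis j 1) - f z\<bar> \<le> K * w \<bar>s\<bar>)"
    using f unfolding modulus_wrt_variable_def by blast
  then obtain K \<delta> where K: "\<And>j. j \<in> J \<Longrightarrow> K j > 0" and \<delta>: "\<And>j. j \<in> J \<Longrightarrow> \<delta> j > (0::real)"
    and fK: "\<And>j z s. j \<in> J \<Longrightarrow> z \<in> D \<Longrightarrow> z + s *\<^sub>R axis j 1 \<in> D \<Longrightarrow> \<bar>s\<bar> < \<delta> j \<Longrightarrow> \<bar>s\<bar> \<in> I \<Longrightarrow>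
        \<bar>f (z + s *\<^sub>R axis j 1) - f z\<bar> \<le> K j * w \<bar>s\<bar>"
    unfolding bchoice_iff by metis
  define \<delta>0 where "\<delta>0 = Min (insert 1 (\<delta> ` J))"
  have \<delta>0: "0 < \<delta>0" "\<delta>0 \<le> 1" "\<And>j. j \<in> J \<Longrightarrow> \<delta>0 \<le> \<delta> j" unfolding \<delta>0_def using \<delta> by auto
  \<comment> \<open>Intermediate points are within \<open>2 * e\<close> of \<open>z\<close> and
    hence within \<open>3 * e\<close> of \<open>z0\<close>, whence the third of \<rho>. The halves
    keep the distance \<open>h\<close>, which is below \<open>2 * e\<close>, under \<open>s0\<close>
    and \<delta>0; the 1 in \<delta>0 covers empty \<open>J\<close> and makes the logarithm
    nonnegative.\<close>
  define e where "e = min (\<rho> / 3) (min (s0 / 2) (\<delta>0 / 2))"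
  have e: "0 < e" unfolding e_def using \<rho> s0 \<delta>0 by simp
  have "\<bar>f z - f z'\<bar> \<le> (2 * (\<Sum>j\<in>J. K j)) * (norm (z - z') * ln (1 / norm (z - z')))"
    if z: "z \<in> ball z0 e" "z' \<in> ball z0 e" "\<forall>i. i \<notin> J \<longrightarrow> z $ i = z' $ i" "z \<noteq> z'" for z z'
  proof -
    define h where "h = norm (z - z')"
    have h0: "0 < h" using z by (simp add: h_def)
    have "h < 2 * e" using dist_triangle_half_l[of z z0 "2 * e" z'] z by (simp add: h_def dist_norm norm_minus_commute)
    hence h: "h < s0" "h < \<delta>0" "h < 1" using \<delta>0 by (auto simp: e_def)
    define W where "W = 2 * (h * ln (1 / h))"
    have wh: "h \<in> I" "w h \<le> W" using s0(2)[OF h0 h(1)] by (auto simp: W_def)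
    have W0: "0 \<le> W" unfolding W_def using h0 h by (intro mult_nonneg_nonneg ln_ge_zero) (auto simp: field_simps)
    \<comment> \<open>\<open>y B\<close> has already taken over the coordinates of \<open>z'\<close>
      in \<open>B\<close>; it runs from \<open>z\<close> to \<open>z'\<close> as \<open>B\<close>
      grows to \<open>J\<close>.\<close>
    define y where "y B = (\<chi> i. if i \<in> B then z' $ i else z $ i)" for B
    have yD: "y B \<in> D" for B
    proof -
      have "norm (y B - z) \<le> norm (z' - z)"
        by (rule norm_le_componentwise_cart) (simp add: y_def)
      hence "norm (y B - z) < 2 * e" using \<open>h < 2 * e\<close> by (simp add: h_def norm_minus_commute)
      hence "dist z0 (y B) < e + 2 * e" using z(1) dist_triangle[of z0 "y B" z]
        by (simp add: dist_norm norm_minus_commute)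
      hence "y B \<in> ball z0 \<rho>" by (simp add: e_def)
      thus ?thesis using \<rho> by blast
    qed
    have "\<bar>f (y B) - f z\<bar> \<le> (\<Sum>j\<in>B. K j) * W" if "B \<subseteq> J" for B
      using finite[of B] that
    proof (induction B rule: finite_induct)
      case empty
      have "y {} = z" by (simp add: y_def vec_eq_iff)
      thus ?case by simp
    next
      case (insert j B)
      define s where "s = z' $ j - z $ j"
      have ys: "y (insert j B) = y B + s *\<^sub>R axis j 1"
        using insert.hyps(2) by (auto simp: y_def vec_eq_iff axis_def s_def)
      have "\<bar>s\<bar> \<le> h" using component_le_norm_cart[of "z' - z" j] by (simp add: s_def h_def norm_minus_commute)
      have "\<bar>f (y (insert j B)) - f (y B)\<bar> \<le> K j * W"
      proof (cases "s = 0")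
        case True
        thus ?thesis using K[of j] insert.prems W0 by (simp add: ys)
      next
        case False
        hence sI: "\<bar>s\<bar> \<in> I" using s0(2)[of "\<bar>s\<bar>"] \<open>\<bar>s\<bar> \<le> h\<close> h by simp
        have "\<bar>f (y (insert j B)) - f (y B)\<bar> \<le> K j * w \<bar>s\<bar>"
          unfolding ys
          by (rule fK) (use insert.prems yD ys[symmetric] sI \<open>\<bar>s\<bar> \<le> h\<close> h \<delta>0(3)[of j] in auto)
        also have "w \<bar>s\<bar> \<le> W" using mono_onD[OF mono sI wh(1) \<open>\<bar>s\<bar> \<le> h\<close>] wh(2) by simp
        hence "K j * w \<bar>s\<bar> \<le> K j * W" using K[of j] insert.prems by simp
        finally show ?thesis .
      qed
      moreover have "\<bar>f (y B) - f z\<bar> \<le> (\<Sum>j\<in>B. K j) * W" using insert by simp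
      ultimately have "\<bar>f (y (insert j B)) - f z\<bar> \<le> K j * W + (\<Sum>j\<in>B. K j) * W" by linarith
      thus ?case using insert.hyps by (simp add: algebra_simps)
    qed
    from this[of J] have "\<bar>f (y J) - f z\<bar> \<le> (\<Sum>j\<in>J. K j) * W" by simp
    moreover have "y J = z'" using z(3) by (simp add: y_def vec_eq_iff)
    ultimately show ?thesis by (simp add: W_def h_def abs_minus_commute mult_ac)
  qed
  moreover have "0 \<le> 2 * (\<Sum>j\<in>J. K j)" using K by (simp add: sum_nonneg less_imp_le)
  ultimately show ?thesis using e by blast
qed

text \<open>Between two points at distance \<open>h\<close> there is a chain with about \<open>h / s\<close> steps of length at most
  \<open>s\<close>, along which \<open>f\<close> varies by at most about \<open>h * w s / s\<close>.\<close>

lemma constant_if_sublinear_modulus: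
  fixes f :: "'a::real_normed_vector \<Rightarrow> 'b::real_normed_vector"
  assumes S: "convex S" and mono: "mono_on I w" and a: "0 < a" "{0<..<a} \<subseteq> I"
    and small: "\<And>\<epsilon> b. 0 < \<epsilon> \<Longrightarrow> 0 < b \<Longrightarrow> \<exists>s. 0 < s \<and> s < b \<and> w s < \<epsilon> * s"
    and f: "\<And>z z'. z \<in> S \<Longrightarrow> z' \<in> S \<Longrightarrow> norm (z - z') \<in> I \<Longrightarrow> norm (f z - f z') \<le> w (norm (z - z'))"
    and z: "z \<in> S" "z' \<in> S"
  shows "f z = f z'"
proof (rule ccontr)
  assume ne: "f z \<noteq> f z'"
  define h where "h = norm (z - z')"
  define d where "d = norm (f z' - f z)"
  have h: "0 < h" and d: "0 < d" using ne by (auto simp: h_def d_def)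
  \<comment> \<open>As \<open>s < h\<close>, there are at most \<open>h / s + 1\<close>, hence at
    most \<open>2 * h / s\<close>, steps. The total variation is then at most
    \<open>2 * h * \<epsilon>\<close>, which is half of \<open>d\<close>.\<close>
  define \<epsilon> where "\<epsilon> = d / (4 * h)"
  have \<epsilon>: "0 < \<epsilon>" using h d by (simp add: \<epsilon>_def)
  obtain s where s: "0 < s" "s < min a h" "w s < \<epsilon> * s" using small[OF \<epsilon>, of "min a h"] a h by auto
  define N where "N = nat \<lceil>h / s\<rceil>"
  have "1 < h / s" using s by simp
  hence N: "h / s \<le> N" "N < h / s + 1" "0 < N" unfolding N_def by linarith+
  have hN: "0 < h / N" "h / N \<le> s" using N h s by (simp_all add: field_simps)
  define p where "p k = z + (real k / N) *\<^sub>R (z' - z)" for k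
  have pS: "p k \<in> S" if "k \<le> N" for k
  proof -
    have "p k = (1 - real k / N) *\<^sub>R z + (real k / N) *\<^sub>R z'" by (simp add: p_def algebra_simps)
    thus ?thesis using convexD_alt[OF S z, of "real k / N"] that N by simp
  qed
  have sI: "h / N \<in> I" "s \<in> I" using hN s a by auto
  \<comment> \<open>The modulus is known to be small only at the scale \<open>s\<close>;
    monotonicity passes this on to the actual step length.\<close>
  have wN: "w (h / N) \<le> \<epsilon> * s" using mono_onD[OF mono sI hN(2)] s by simp
  have "norm (f (p k) - f z) \<le> k * (\<epsilon> * s)" if "k \<le> N" for k
    using that
  proof (induction k)
    case 0
    thus ?case by (simp add: p_def)
  next
    case (Suc k)
    have "p (Suc k) - p k = (1 / N) *\<^sub>R (z' - z)"
      unfolding p_def by (simp add: scaleR_left_diff_distrib[symmetric] diff_divide_distrib[symmetric])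
    hence pk: "norm (p (Suc k) - p k) = h / N" by (simp add: h_def norm_minus_commute)
    have "norm (f (p (Suc k)) - f (p k)) \<le> w (h / N)"
      using f[of "p (Suc k)" "p k"] pS Suc.prems sI pk by simp
    hence "norm (f (p (Suc k)) - f (p k)) \<le> \<epsilon> * s" using wN by simp
    moreover have "norm (f (p k) - f z) \<le> k * (\<epsilon> * s)" using Suc by simp
    ultimately have "norm (f (p (Suc k)) - f z) \<le> \<epsilon> * s + k * (\<epsilon> * s)"
      using norm_triangle_ineq[of "f (p (Suc k)) - f (p k)" "f (p k) - f z"] by simp
    thus ?case by (simp add: algebra_simps)
  qed
  from this[of N] have "d \<le> N * (\<epsilon> * s)" using N by (simp add: p_def d_def)
  also have "\<dots> \<le> (h / s + 1) * (\<epsilon> * s)" using N \<epsilon> s by (intro mult_right_mono) auto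
  also have "\<dots> = \<epsilon> * (h + s)" using s by (simp add: field_simps)
  also have "\<dots> \<le> \<epsilon> * (2 * h)" using s \<epsilon> by (intro mult_left_mono) auto
  also have "\<dots> = d / 2" using h by (simp add: \<epsilon>_def)
  finally show False using d by simp
qed

section \<open>Complements and projections\<close>

lemma span_axes: "span ((\<lambda>j. axis j 1) ` J) = (coordinate_plane J :: (real^'d::finite) set)"
proof
  show "span ((\<lambda>j. axis j 1) ` J) \<subseteq> (coordinate_plane J :: (real^'d) set)"
    by (intro span_minimal subspace_coordinate_plane) (auto simp: coordinate_plane_def axis_def)
  show "(coordinate_plane J :: (real^'d) set) \<subseteq> span ((\<lambda>j. axis j 1) ` J)"
  proof
    fix v :: "real^'d" assume v: "v \<in> coordinate_plane J"
    have "v = (\<Sum>j\<in>J. v $ j *\<^sub>R axis j 1)"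
      using v by (auto simp: vec_eq_iff axis_def coordinate_plane_def if_distrib sum.delta cong: if_cong)
    moreover have "(\<Sum>j\<in>J. v $ j *\<^sub>R axis j 1) \<in> span ((\<lambda>j. axis j (1::real)) ` J)"
      by (intro span_sum span_scale span_base) auto
    ultimately show "v \<in> span ((\<lambda>j. axis j 1) ` J)" by simp
  qed
qed

lemma dim_coordinate_plane: "dim (coordinate_plane J :: (real^'d::finite) set) = card J"
proof -
  have "independent ((\<lambda>j. axis j (1::real)) ` J)"
    by (rule independent_mono[OF independent_Basis]) (auto simp: Basis_vec_def)
  moreover have "inj_on (\<lambda>j. axis j (1::real)) J" by (auto simp: inj_on_def axis_eq_axis)
  ultimately show ?thesis
    by (simp add: span_axes[symmetric] dim_eq_card_independent card_image)
qed

text \<open>The dimension formula leaves dimension 0 for the intersection. Transversality is given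
  as a sum filling the space, while \<open>slice_section\<close> needs it in this form.\<close>

lemma complement_inter_trivial:
  fixes F G :: "('a::euclidean_space) set"
  assumes "subspace F" "subspace G" "{a + b | a b. a \<in> F \<and> b \<in> G} = UNIV" "dim F + dim G = DIM('a)"
    and "v \<in> F" "v \<in> G"
  shows "v = 0"
proof -
  have "dim (F \<inter> G) = 0" using dim_sums_Int[OF assms(1,2)] assms(3,4) by simp
  thus ?thesis using assms(5,6) by auto
qed

text \<open>A linear extension of the identity on \<open>F\<close> with values in \<open>F\<close>
  is a projection. It supplies \<pi> when \<open>E\<close> is locally constant and the chart need
  not have coordinates adapted to \<open>E\<close>.\<close>

lemma exists_projection_onto_subspace:
  fixes F :: "('a::euclidean_space) set"
  assumes F: "subspace F"
  obtains \<pi> :: "'a \<Rightarrow> 'a" where "linear \<pi>" "\<And>v. \<pi> (\<pi> v) = \<pi> v" "\<And>v. v \<in> F \<Longrightarrow> \<pi> v = v"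
    "dim F + dim {v. \<pi> v = 0} = DIM('a)"
proof -
  obtain \<pi> where \<pi>: "range \<pi> \<subseteq> F" "linear \<pi>" "\<forall>v\<in>F. \<pi> v = v"
    using linear_exists_left_inverse_on[OF linear_id F] by auto
  interpret \<pi>: linear \<pi> by (rule \<pi>(2))
  let ?G = "{v. \<pi> v = 0}"
  have G: "subspace ?G" by (rule linear_subspace_kernel[OF \<pi>(2)])
  have "v \<in> {a + b | a b. a \<in> F \<and> b \<in> ?G}" for v
  proof -
    have "\<pi> v \<in> F" using \<pi>(1) by blast
    moreover from this have "\<pi> (v - \<pi> v) = 0" using \<pi>(3) by (simp add: \<pi>.diff)
    moreover have "v = \<pi> v + (v - \<pi> v)" by simp
    ultimately show ?thesis by blast
  qed
  hence "{a + b | a b. a \<in> F \<and> b \<in> ?G} = UNIV" by blast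
  moreover have "F \<inter> ?G = {0}" using \<pi>(3) subspace_0[OF F] subspace_0[OF G] by auto
  ultimately have "dim F + dim ?G = DIM('a)" using dim_sums_Int[OF F G] by simp
  moreover have "\<pi> (\<pi> v) = \<pi> v" for v
    using \<pi>(1) by (intro bspec[OF \<pi>(3)]) blast
  ultimately show thesis using that[of \<pi>] \<pi> by blast
qed

section \<open>Local containment in the two cases\<close>

text \<open>The projection erases the coordinates in \<open>J\<close>. Points of a common fibre thus
  differ only in these coordinates, where the transversal modulus gives a logarithmic bound for each
  of the finitely many component functions of the frame.\<close>

lemma integral_manifold_locally_contained_transversal:
  fixes A :: "('a::{t2_space,second_countable_topology}, 'd::finite) chart set"
  assumes r: "1 \<le> r" and A: "Cr_atlas r A" and mn: "CARD('d) = m + n" and E: "tangent_subbundle r A m E"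
    and w: "modulus I w" and tr: "has_transversal_modulus r A m n E I w"
    and s0: "0 < s0" "\<And>s. 0 < s \<Longrightarrow> s < s0 \<Longrightarrow> s \<in> I \<and> w s \<le> 2 * (s * ln (1 / s))"
    and N1: "integral_manifold r A m E N1" "p \<in> N1" and N2: "integral_manifold r A m E N2" "p \<in> N2"
  shows "\<exists>U. open U \<and> p \<in> U \<and> N1 \<inter> U \<subseteq> N2"
proof -
  have pA: "p \<in> carrier_of A" using N1 unfolding integral_manifold_def C1_submanifold_def by blast
  obtain c J X where c: "c \<in> charts_at r A p" and J: "card J = n"
    and sum: "\<forall>q\<in>fst c. {a + b | a b. a \<in> components c (E q) \<and> b \<in> span ((\<lambda>j. axis j 1) ` J)} = UNIV"
    and X: "local_frame m E c (fst c) X"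
    and Xw: "\<forall>i<m. \<forall>k. \<forall>j\<in>J. modulus_wrt_variable I w j (snd c ` fst c)
              (\<lambda>z. X i (inv_into (fst c) (snd c) z) $ k)"
    using tr pA unfolding has_transversal_modulus_def by meson
  have cc: "is_chart c" "p \<in> fst c" using c by (auto simp: charts_at_def max_atlas_def)
  let ?D = "snd c ` fst c" and ?z0 = "snd c p"
  let ?Y = "\<lambda>i z. X i (inv_into (fst c) (snd c) z)"
  have mono: "mono_on I w" using w by (simp add: modulus_def)
  define Q where "Q i k L e \<longleftrightarrow> 0 \<le> L \<and> 0 < e \<and>
      (\<forall>z\<in>ball ?z0 e. \<forall>z'\<in>ball ?z0 e. (\<forall>i. i \<notin> J \<longrightarrow> z $ i = z' $ i) \<longrightarrow> z \<noteq> z' \<longrightarrow>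
        \<bar>?Y i z $ k - ?Y i z' $ k\<bar> \<le> L * (norm (z - z') * ln (1 / norm (z - z'))))" for i k L e
  have "\<exists>L e. Q i k L e" if "i < m" for i k
    using log_lipschitz_along_coordinates[OF mono s0 is_chart_open_image[OF cc(1)] imageI[OF cc(2)],
        of J "\<lambda>z. ?Y i z $ k"] Xw that
    unfolding Q_def by auto
  then obtain L e where Q: "\<And>i k. i < m \<Longrightarrow> Q i k (L i k) (e i k)" by metis
  have L: "\<And>i k. i < m \<Longrightarrow> 0 \<le> L i k" and e: "\<And>i k. i < m \<Longrightarrow> 0 < e i k"
    using Q by (auto simp: Q_def)
  have Le: "\<bar>?Y i z $ k - ?Y i z' $ k\<bar> \<le> L i k * (norm (z - z') * ln (1 / norm (z - z')))"
    if "i < m" "z \<in> ball ?z0 (e i k)" "z' \<in> ball ?z0 (e i k)" "\<forall>i. i \<notin> J \<longrightarrow> z $ i = z' $ i" "z \<noteq> z'"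
    for i k z z'
    using Q[OF that(1), of k] that(2-5) unfolding Q_def by blast
  \<comment> \<open>The inserted \<open>1/2\<close> keeps distances within the ball below 1, so that
    the logarithms are nonnegative, and covers \<open>m = 0\<close>.\<close>
  define e0 where "e0 = Min (insert (1/2) ((\<lambda>(i, k). e i k) ` ({..<m} \<times> UNIV)))"
  have "finite (insert (1/2) ((\<lambda>(i, k). e i k) ` ({..<m} \<times> UNIV)))" by simp
  note fin = this
  have e0: "0 < e0" unfolding e0_def using e by (subst Min_gr_iff[OF fin]) auto
  have e0_half: "e0 \<le> 1/2" unfolding e0_def by (rule Min_le[OF fin]) simp
  have e0_le: "e0 \<le> e i k" if "i < m" for i k
    unfolding e0_def using that by (intro Min_le[OF fin]) force
  define L0 where "L0 = (\<Sum>i<m. \<Sum>k\<in>UNIV. L i k)"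
  have L0: "0 \<le> L0" unfolding L0_def using L by (intro sum_nonneg) auto
  define V where "V = fst c \<inter> snd c -` ball ?z0 e0"
  define \<pi> :: "real^'d \<Rightarrow> real^'d" where "\<pi> v = (\<chi> i. if i \<in> J then 0 else v $ i)" for v
  have ker: "{v. \<pi> v = 0} = coordinate_plane J"
    by (auto simp: \<pi>_def coordinate_plane_def vec_eq_iff)
  show ?thesis
  proof (rule integral_manifold_locally_contained[OF r A c N1 N2, where V = V and X = X and \<pi> = \<pi> and L = L0])
    show "open V" unfolding V_def by (rule is_chart_open_preimage[OF cc(1) open_ball])
    show "p \<in> V" "V \<subseteq> fst c" using cc e0 by (auto simp: V_def)
    then show "local_frame m E c V X"
      using X unfolding local_frame_def by (meson continuous_on_subset subsetD)
    show "linear \<pi>" by (intro linearI) (auto simp: \<pi>_def vec_eq_iff)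
    show "\<pi> (\<pi> v) = \<pi> v" for v by (simp add: \<pi>_def vec_eq_iff)
    show "m + dim {v. \<pi> v = 0} = CARD('d)" using mn J by (simp add: ker dim_coordinate_plane)
    show "v = 0" if "v \<in> components c (E p)" "\<pi> v = 0" for v
    proof (rule complement_inter_trivial)
      show "subspace (components c (E p))" using E pA c unfolding tangent_subbundle_def by blast
      show "subspace (coordinate_plane J)" by (rule subspace_coordinate_plane)
      show "{a + b | a b. a \<in> components c (E p) \<and> b \<in> coordinate_plane J} = UNIV"
        using bspec[OF sum cc(2)] by (simp add: span_axes)
      have "dim (components c (E p)) = m" using E pA c unfolding tangent_subbundle_def by blast
      thus "dim (components c (E p)) + dim (coordinate_plane J) = DIM(real^'d)"
        using mn J by (simp add: dim_coordinate_plane)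
      show "v \<in> components c (E p)" by fact
      show "v \<in> coordinate_plane J" using that(2) ker by blast
    qed
    show "0 \<le> L0" by fact
    fix i q q' assume q: "i < m" "q \<in> V" "q' \<in> V" "snd c q \<noteq> snd c q'" "\<pi> (snd c q) = \<pi> (snd c q')"
    define h where "h = norm (snd c q - snd c q')"
    have h0: "0 < h" using q by (simp add: h_def)
    have "h < 2 * e0" using dist_triangle_half_l[of "snd c q" ?z0 "2 * e0" "snd c q'"] q
      by (simp add: V_def h_def dist_norm norm_minus_commute)
    hence W: "0 \<le> h * ln (1 / h)" using h0 e0_half by (intro mult_nonneg_nonneg ln_ge_zero) (auto simp: field_simps)
    have J': "\<forall>i. i \<notin> J \<longrightarrow> snd c q $ i = snd c q' $ i"
      using q(5) by (auto simp: \<pi>_def vec_eq_iff split: if_splits)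
    have k: "\<bar>X i q $ k - X i q' $ k\<bar> \<le> L i k * (h * ln (1 / h))" for k
      using Le[OF q(1) _ _ J' q(4), of k] q(2,3) e0_le[OF q(1), of k] is_chart_inv[OF cc(1)]
      by (auto simp: V_def h_def)
    have "norm (X i q - X i q') \<le> (\<Sum>k\<in>UNIV. \<bar>(X i q - X i q') $ k\<bar>)" by (rule norm_le_l1_cart)
    also have "\<dots> \<le> (\<Sum>k\<in>UNIV. L i k * (h * ln (1 / h)))" by (intro sum_mono) (simp add: k)
    also have "\<dots> = (\<Sum>k\<in>UNIV. L i k) * (h * ln (1 / h))" by (rule sum_distrib_right[symmetric])
    also have "\<dots> \<le> L0 * (h * ln (1 / h))"
      unfolding L0_def using q(1) L W by (intro mult_right_mono member_le_sum) (auto intro!: sum_nonneg)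
    finally show "norm (X i q - X i q') \<le> L0 * (norm (snd c q - snd c q') * ln (1 / norm (snd c q - snd c q')))"
      by (simp add: h_def)
  qed
qed

text \<open>In a chart of \<open>A\<close>, to which \<open>has_modulus\<close> refers, the frame is
  constant near \<open>p\<close>. The comparison then holds with \<open>L = 0\<close>, and any
  projection onto the components of \<open>E p\<close> can play the role of \<pi>.\<close>

lemma integral_manifold_locally_contained_constant:
  fixes A :: "('a::{t2_space,second_countable_topology}, 'd::finite) chart set"
  assumes r: "1 \<le> r" and A: "Cr_atlas r A" and E: "tangent_subbundle r A m E"
    and w: "modulus I w" and mod: "has_modulus A m E I w"
    and small: "\<And>\<epsilon> b. 0 < \<epsilon> \<Longrightarrow> 0 < b \<Longrightarrow> \<exists>s. 0 < s \<and> s < b \<and> w s < \<epsilon> * s"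
    and N1: "integral_manifold r A m E N1" "p \<in> N1" and N2: "integral_manifold r A m E N2" "p \<in> N2"
  shows "\<exists>U. open U \<and> p \<in> U \<and> N1 \<inter> U \<subseteq> N2"
proof -
  have pA: "p \<in> carrier_of A" using N1 unfolding integral_manifold_def C1_submanifold_def by blast
  then obtain c where cA: "c \<in> A" and pc: "p \<in> fst c" by (auto simp: carrier_of_def)
  have cc: "is_chart c" using A cA by (auto simp: Cr_atlas_def)
  have c: "c \<in> charts_at r A p"
    using A cA pc by (auto simp: charts_at_def max_atlas_def Cr_atlas_def carrier_of_def)
  let ?z0 = "snd c p"
  obtain W where W: "open W" "p \<in> W" "W \<subseteq> fst c"
    and WV: "\<And>V. open V \<Longrightarrow> V \<subseteq> W \<Longrightarrow> \<exists>X. local_frame m E c V X \<and>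
              (\<forall>i<m. \<forall>p\<in>V. \<forall>q\<in>V. norm (snd c p - snd c q) \<in> I \<longrightarrow>
                 norm (X i p - X i q) \<le> w (norm (snd c p - snd c q)))"
    using mod cA pc unfolding has_modulus_def by meson
  obtain e where e: "0 < e" "ball ?z0 e \<subseteq> snd c ` W"
    using is_chart_open_image_subset[OF cc W(1,3)] W(2) open_contains_ball by blast
  \<comment> \<open>\<open>V\<close> must correspond to a ball in coordinates: the subdivision
    argument needs a convex set.\<close>
  define V where "V = fst c \<inter> snd c -` ball ?z0 e"
  have oV: "open V" unfolding V_def by (rule is_chart_open_preimage[OF cc open_ball])
  have "q \<in> W" if q: "q \<in> V" for q
  proof -
    have "snd c q \<in> snd c ` W" using q e by (auto simp: V_def)
    then obtain q' where "q' \<in> W" "snd c q = snd c q'" by blast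
    thus ?thesis using is_chart_inj[OF cc, of q q'] q W(3) by (auto simp: V_def)
  qed
  then obtain X where X: "local_frame m E c V X"
    and Xw: "\<forall>i<m. \<forall>p\<in>V. \<forall>q\<in>V. norm (snd c p - snd c q) \<in> I \<longrightarrow>
                 norm (X i p - X i q) \<le> w (norm (snd c p - snd c q))"
    using WV[OF oV] by blast
  have inV: "inv_into (fst c) (snd c) z \<in> V \<and> snd c (inv_into (fst c) (snd c) z) = z" if z: "z \<in> ball ?z0 e" for z
  proof -
    obtain q where q: "z = snd c q" "q \<in> W" using subsetD[OF e(2) z] by (elim imageE)
    hence "inv_into (fst c) (snd c) z = q" using is_chart_inv[OF cc] W(3) by blast
    thus ?thesis using q z W(3) by (auto simp: V_def)
  qed
  have mono: "mono_on I w" using w by (simp add: modulus_def)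
  obtain a where a: "0 < a" "{0<..<a} \<subseteq> I" using w unfolding modulus_def by blast
  have const: "X i q = X i q'" if i: "i < m" and q: "q \<in> V" "q' \<in> V" for i q q'
  proof -
    have "X i (inv_into (fst c) (snd c) (snd c q)) = X i (inv_into (fst c) (snd c) (snd c q'))"
    proof (rule constant_if_sublinear_modulus[OF convex_ball mono a small,
          where f = "\<lambda>z. X i (inv_into (fst c) (snd c) z)"])
      show "norm (X i (inv_into (fst c) (snd c) z) - X i (inv_into (fst c) (snd c) z')) \<le> w (norm (z - z'))"
        if "z \<in> ball ?z0 e" "z' \<in> ball ?z0 e" "norm (z - z') \<in> I" for z z'
        using Xw[rule_format, OF i, of "inv_into (fst c) (snd c) z" "inv_into (fst c) (snd c) z'"]
          inV[OF that(1)] inV[OF that(2)] that(3) by simp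
    qed (use q in \<open>auto simp: V_def\<close>)
    thus ?thesis using q is_chart_inv[OF cc] by (simp add: V_def)
  qed
  have F: "subspace (components c (E p))" "dim (components c (E p)) = m"
    using E pA c unfolding tangent_subbundle_def by blast+
  obtain \<pi> :: "real^'d \<Rightarrow> real^'d" where \<pi>: "linear \<pi>" "\<And>v. \<pi> (\<pi> v) = \<pi> v" "\<And>v. v \<in> components c (E p) \<Longrightarrow> \<pi> v = v"
    "dim (components c (E p)) + dim {v. \<pi> v = 0} = DIM(real^'d)"
    by (rule exists_projection_onto_subspace[OF F(1)]) blast
  show ?thesis
  proof (rule integral_manifold_locally_contained[OF r A c N1 N2 oV, where X = X and \<pi> = \<pi> and L = 0])
    show "p \<in> V" "V \<subseteq> fst c" using pc e by (auto simp: V_def)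
    show "local_frame m E c V X" by (rule X)
    show "m + dim {v. \<pi> v = 0} = CARD('d)" using \<pi>(4) F(2) by simp
    show "norm (X i q - X i q') \<le> 0 * (norm (snd c q - snd c q') * ln (1 / norm (snd c q - snd c q')))"
      if "i < m" "q \<in> V" "q' \<in> V" for i q q'
      using const[OF that] by simp
    show "v = 0" if "v \<in> components c (E p)" "\<pi> v = 0" for v using \<pi>(3) that by simp
  qed (use \<pi>(1,2) in simp_all)
qed

theorem theorem3:
  fixes A :: "('a::{t2_space,second_countable_topology}, 'd::finite) chart set"
    and r :: enat and m n :: nat
    and E :: "'a \<Rightarrow> ('a, 'd) tvec set"
    and I\<^sub>1 I\<^sub>2 :: "real set" and w\<^sub>1 w\<^sub>2 :: "real \<Rightarrow> real"
  assumes "1 \<le> r" and "Cr_atlas r A" and "CARD('d) = m + n"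
    and "continuous_subbundle r A m E"
    and "modulus I\<^sub>1 w\<^sub>1" and "has_modulus A m E I\<^sub>1 w\<^sub>1"
    and "modulus I\<^sub>2 w\<^sub>2" and "has_transversal_modulus r A m n E I\<^sub>2 w\<^sub>2"
    and "integrable_bundle r A m E"
    and "((\<lambda>s. w\<^sub>1 s * exp (w\<^sub>2 s / s)) \<longlongrightarrow> 0) (at_right 0)"
  shows "uniquely_integrable r A m E"
proof -
  have E: "tangent_subbundle r A m E" using assms(4) by (simp add: continuous_subbundle_def)
  \<comment> \<open>One inclusion suffices: exchanging the two manifolds gives openness in the other
    one.\<close>
  have local: "\<exists>U. open U \<and> p \<in> U \<and> N1 \<inter> U \<subseteq> N2"
    if N1: "integral_manifold r A m E N1" "p \<in> N1" and N2: "integral_manifold r A m E N2" "p \<in> N2"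
    for p N1 N2
  proof (cases "\<exists>c>0. \<forall>\<^sub>F s in at_right 0. c * s \<le> w\<^sub>1 s")
    case True
    then obtain c where c: "c > 0" "\<forall>\<^sub>F s in at_right 0. c * s \<le> w\<^sub>1 s" by blast
    obtain a where a: "{0<..<a} \<subseteq> I\<^sub>2" "0 < a" using assms(7) unfolding modulus_def by blast
    obtain s0 where "0 < s0" "\<And>s. 0 < s \<Longrightarrow> s < s0 \<Longrightarrow> s \<in> I\<^sub>2 \<and> w\<^sub>2 s \<le> 2 * (s * ln (1 / s))"
      using log_bound_from_exponential_condition[OF a c assms(10)] by blast
    from integral_manifold_locally_contained_transversal[OF assms(1-3) E assms(7,8) this N1 N2]
    show ?thesis .
  next
    case False
    \<comment> \<open>The failure of every linear lower bound yields small scales \<open>s\<close>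
      with \<open>w\<^sub>1 s\<close> below \<epsilon> times \<open>s\<close>, though not all small
      scales.\<close>
    have "\<exists>s. 0 < s \<and> s < b \<and> w\<^sub>1 s < \<epsilon> * s" if "0 < \<epsilon>" "0 < b" for \<epsilon> b
      using False that unfolding eventually_at_right_field by (meson not_le)
    from integral_manifold_locally_contained_constant[OF assms(1,2) E assms(5,6) this N1 N2]
    show ?thesis .
  qed
  have "openin (top_of_set N1) (N1 \<inter> N2)"
    if N: "integral_manifold r A m E N1" "integral_manifold r A m E N2" for N1 N2
  proof (subst openin_subopen, intro ballI)
    fix p assume p: "p \<in> N1 \<inter> N2"
    from local[OF N(1) IntD1[OF p] N(2) IntD2[OF p]]
    obtain U where "open U" "p \<in> U" "N1 \<inter> U \<subseteq> N2" by (elim exE conjE)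
    thus "\<exists>T. openin (top_of_set N1) T \<and> p \<in> T \<and> T \<subseteq> N1 \<inter> N2"
      using p by (intro exI[of _ "N1 \<inter> U"]) (auto intro: openin_open_Int)
  qed
  thus ?thesis
    using assms(9) unfolding uniquely_integrable_def by (metis inf_commute)
qed

end
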